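(* For all integers $g,n\ge0$ and all $d>0$, there is a deformation retract $$\Delta^{\mathrm{vir}}_{g,n}(d)\times[0,1]\to\Delta^{\mathrm{vir}}_{g,n}(d)$$ of the virtual dual complex onto a point. In other words, $\Delta^{\mathrm{vir}}_{g,n}(d)$ is contractible.
   Context: A $(g,n,d)$-graph is a tuple $\mathbf{G}=(G,w,\delta,m)$ where $G$ is a connected graph (loops and multiple edges allowed), $w,\delta:V(\mathbf{G})\to\mathbb{Z}_{\ge0}$ are functions (genus and degree), $m:\{1,\dots,n\}\to V(\mathbf{G})$ is a marking function, $\dim_{\mathbb{Q}}H_1(G,\mathbb{Q})+\sum_vw(v)=g$ and $\sum_v\delta(v)=d$. It is stable if $2w(v)-2+\mathrm{val}(v)+|m^{-1}(v)|>0$ for every vertex $v$ with $\delta(v)=0$, where $\mathrm{val}(v)$ is the valence of $v$. Isomorphisms of $(g,n,d)$-graphs are graph isomorphisms respecting $w,\delta,m$. Contracting a non-loop edge merges its two endpoints, adding the values of $w$ and of $\delta$ and uniting the markings; contracting a loop deletes it and increases $w$ of its vertex by $1$. $\Gamma_{g,n}(d)$ is the category of stable $(g,n,d)$-graphs with morphisms the compositions of isomorphisms and edge contractions. For a stable $(g,n,d)$-graph $\mathbf{G}$ with edge set $E(\mathbf{G})$ let $$\kappa_{\mathbf{G}}=\Big\{\ell:E(\mathbf{G})\to\mathbb{R}_{\ge0}\ \Big|\ \sum_{e\in E(\mathbf{G})}\ell(e)=1\Big\}.$$ A morphism $\mathbf{G}\to\mathbf{G}'$ induces an inclusion $\kappa_{\mathbf{G}'}\to\kappa_{\mathbf{G}}$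 (extending a metric by $0$ on contracted edges), giving a functor from $\Gamma_{g,n}(d)^{\mathrm{op}}$ to topological spaces. The virtual dual complex $\Delta^{\mathrm{vir}}_{g,n}(d)$ is the colimit of this functor.
   Formalization: The deformation retraction onto a point is claimed except when g = 0, n ≤ 1, d = 1: there the only stable graph is one vertex without edges, so the virtual dual complex is empty and cannot retract onto a point (it counts as contractible only by the convention for the empty space). *)

theory Defs
  imports "HOL-Analysis.Analysis" "HOL-Library.Function_Algebras"
begin

section \<open>Graphs with genera, degrees and markings\<close>

text \<open>
  A finite multigraph with loops: \<open>ends e\<close> is the set of endpoints of \<open>e\<close>, with two elements, or one
  if \<open>e\<close> is a loop. Vertices and edges are labelled by natural numbers; every finite graph is
  isomorphic to one of this form, so the resulting category is small and equivalent to the category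
  of all finite graphs, and has the same colimits. Values of the functions outside \<open>verts\<close>, \<open>edges\<close>
  and \<open>{1..n}\<close> are irrelevant: graphs differing only there are isomorphic.
\<close>

record wgraph =
  verts :: "nat set"
  edges :: "nat set"
  ends :: "nat \<Rightarrow> nat set"
  genus :: "nat \<Rightarrow> nat"
  deg :: "nat \<Rightarrow> nat"
  mark :: "nat \<Rightarrow> nat"

definition is_multigraph :: "wgraph \<Rightarrow> bool" where
  "is_multigraph G \<longleftrightarrow>
     finite (verts G) \<and> finite (edges G) \<and>
     (\<forall>e\<in>edges G. ends G e \<subseteq> verts G \<and> card (ends G e) \<in> {1, 2})"

definition adjacency :: "wgraph \<Rightarrow> (nat \<times> nat) set" where
  "adjacency G = {(u, v). \<exists>e\<in>edges G. ends G e = {u, v}}"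

definition is_connected :: "wgraph \<Rightarrow> bool" where
  "is_connected G \<longleftrightarrow>
     verts G \<noteq> {} \<and> (\<forall>u\<in>verts G. \<forall>v\<in>verts G. (u, v) \<in> (adjacency G)\<^sup>*)"

definition is_loop :: "wgraph \<Rightarrow> nat \<Rightarrow> bool" where
  "is_loop G e \<longleftrightarrow> card (ends G e) = 1"

text \<open>The valence counts half-edges, so a loop counts twice.\<close>

definition valence :: "wgraph \<Rightarrow> nat \<Rightarrow> nat" where
  "valence G v = (\<Sum>e | e \<in> edges G \<and> v \<in> ends G e. if is_loop G e then 2 else 1)"

text \<open>
  The first homology with rational coefficients. Each edge is oriented from its smaller to its larger
  endpoint, so that \<open>boundary_coeff G v e\<close> is the coefficient of \<open>v\<close> in the boundary of \<open>e\<close> (zero for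
  loops). As a graph has no 2-cells, \<open>H\<^sub>1\<close> is the kernel of the boundary map.
\<close>

definition boundary_coeff :: "wgraph \<Rightarrow> nat \<Rightarrow> nat \<Rightarrow> rat" where
  "boundary_coeff G v e = of_bool (v = Max (ends G e)) - of_bool (v = Min (ends G e))"

definition H1 :: "wgraph \<Rightarrow> (nat \<Rightarrow> rat) set" where
  "H1 G = {c. (\<forall>e. e \<notin> edges G \<longrightarrow> c e = 0) \<and>
              (\<forall>v\<in>verts G. (\<Sum>e\<in>edges G. c e * boundary_coeff G v e) = 0)}"

definition dim_H1 :: "wgraph \<Rightarrow> nat" where
  "dim_H1 G = vector_space.dim (\<lambda>(a::rat) (c::nat \<Rightarrow> rat) e. a * c e) (H1 G)"

definition gnd_graph :: "nat \<Rightarrow> nat \<Rightarrow> nat \<Rightarrow> wgraph \<Rightarrow> bool" where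
  "gnd_graph g n d G \<longleftrightarrow>
     is_multigraph G \<and> is_connected G \<and>
     mark G ` {1..n} \<subseteq> verts G \<and>
     dim_H1 G + (\<Sum>v\<in>verts G. genus G v) = g \<and>
     (\<Sum>v\<in>verts G. deg G v) = d"

definition stable :: "nat \<Rightarrow> wgraph \<Rightarrow> bool" where
  "stable n G \<longleftrightarrow>
     (\<forall>v\<in>verts G. deg G v = 0 \<longrightarrow>
        2 * int (genus G v) - 2 + int (valence G v) + int (card {i \<in> {1..n}. mark G i = v}) > 0)"

definition stable_graphs :: "nat \<Rightarrow> nat \<Rightarrow> nat \<Rightarrow> wgraph set" where
  "stable_graphs g n d = {G. gnd_graph g n d G \<and> stable n G}"


section \<open>Isomorphisms, edge contractions and morphisms\<close>

definition graph_iso ::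
    "nat \<Rightarrow> wgraph \<Rightarrow> wgraph \<Rightarrow> (nat \<Rightarrow> nat) \<Rightarrow> (nat \<Rightarrow> nat) \<Rightarrow> bool" where
  "graph_iso n G G' f h \<longleftrightarrow>
     bij_betw f (verts G) (verts G') \<and> bij_betw h (edges G) (edges G') \<and>
     (\<forall>e\<in>edges G. ends G' (h e) = f ` ends G e) \<and>
     (\<forall>v\<in>verts G. genus G' (f v) = genus G v \<and> deg G' (f v) = deg G v) \<and>
     (\<forall>i\<in>{1..n}. mark G' i = f (mark G i))"

text \<open>
  Contracting a non-loop edge \<open>e\<close> keeps its smaller endpoint as the merged vertex; another choice of
  name gives an isomorphic graph.
\<close>

definition contract_nonloop :: "nat \<Rightarrow> wgraph \<Rightarrow> wgraph" where
  "contract_nonloop e G =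
     (let u = Min (ends G e); v = Max (ends G e); r = (\<lambda>x. if x = v then u else x) in
      \<lparr> verts = verts G - {v},
        edges = edges G - {e},
        ends = (\<lambda>e'. r ` ends G e'),
        genus = (genus G)(u := genus G u + genus G v),
        deg = (deg G)(u := deg G u + deg G v),
        mark = (\<lambda>i. r (mark G i)) \<rparr>)"

definition contract_loop :: "nat \<Rightarrow> wgraph \<Rightarrow> wgraph" where
  "contract_loop e G =
     G \<lparr> edges := edges G - {e},
         genus := (\<lambda>v. if v \<in> ends G e then genus G v + 1 else genus G v) \<rparr>"

definition contract :: "nat \<Rightarrow> wgraph \<Rightarrow> wgraph" where
  "contract e G = (if is_loop G e then contract_loop e G else contract_nonloop e G)"

text \<open>
  \<open>morphism g n d G \<phi> G'\<close>: there is a morphism from \<open>G\<close> to \<open>G'\<close> whose effect on edges is \<open>\<phi>\<close>, where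
  \<open>\<phi> e = None\<close> if \<open>e\<close> is contracted and \<open>\<phi> e = Some e'\<close> if \<open>e\<close> becomes \<open>e'\<close>. The effect on edges is
  all that the induced map of spaces of metrics depends on.
\<close>

inductive morphism ::
    "nat \<Rightarrow> nat \<Rightarrow> nat \<Rightarrow> wgraph \<Rightarrow> (nat \<Rightarrow> nat option) \<Rightarrow> wgraph \<Rightarrow> bool"
  for g n d where
  iso: "\<lbrakk>G \<in> stable_graphs g n d; G' \<in> stable_graphs g n d; graph_iso n G G' f h\<rbrakk>
    \<Longrightarrow> morphism g n d G (\<lambda>e. Some (h e)) G'"
| contraction: "\<lbrakk>G \<in> stable_graphs g n d; contract e G \<in> stable_graphs g n d; e \<in> edges G\<rbrakk>
    \<Longrightarrow> morphism g n d G (\<lambda>e'. if e' = e then None else Some e') (contract e G)"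
| comp: "\<lbrakk>morphism g n d G \<phi> G'; morphism g n d G' \<psi> G''\<rbrakk>
    \<Longrightarrow> morphism g n d G (\<lambda>e. Option.bind (\<phi> e) \<psi>) G''"


section \<open>Spaces of metrics\<close>

definition kappa :: "wgraph \<Rightarrow> (nat \<Rightarrow> real) topology" where
  "kappa G = subtopology (powertop_real (edges G))
     {l. (\<forall>e\<in>edges G. 0 \<le> l e) \<and> (\<Sum>e\<in>edges G. l e) = 1}"

text \<open>
  The map induced on metrics by a morphism from \<open>G\<close>. Points of the product topology are functions
  that are undefined outside the index set, whence \<open>restrict\<close>.
\<close>

definition extend_metric ::
    "wgraph \<Rightarrow> (nat \<Rightarrow> nat option) \<Rightarrow> (nat \<Rightarrow> real) \<Rightarrow> (nat \<Rightarrow> real)" where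
  "extend_metric G \<phi> l = restrict (\<lambda>e. case \<phi> e of None \<Rightarrow> 0 | Some e' \<Rightarrow> l e') (edges G)"


section \<open>Colimits of topological spaces\<close>

text \<open>
  A diagram is given by spaces \<open>X i\<close> for \<open>i \<in> I\<close> and a set \<open>M\<close> of arrows \<open>(i, j, f)\<close>, each standing
  for a continuous map \<open>f\<close> from \<open>X i\<close> to \<open>X j\<close>. Its colimit is the disjoint union of the spaces modulo
  the equivalence relation generated by \<open>x \<sim> f x\<close>, with the quotient topology.
\<close>

definition colimit_rel ::
    "('i \<Rightarrow> 'a topology) \<Rightarrow> 'i set \<Rightarrow> ('i \<times> 'i \<times> ('a \<Rightarrow> 'a)) set \<Rightarrow> (('i \<times> 'a) \<times> ('i \<times> 'a)) set" where
  "colimit_rel X I M =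
     {(p, q). p \<in> topspace (sum_topology X I) \<and> q \<in> topspace (sum_topology X I) \<and>
        equivclp (\<lambda>p q. \<exists>(i, j, f)\<in>M. \<exists>x\<in>topspace (X i). p = (i, x) \<and> q = (j, f x)) p q}"

definition colimit ::
    "('i \<Rightarrow> 'a topology) \<Rightarrow> 'i set \<Rightarrow> ('i \<times> 'i \<times> ('a \<Rightarrow> 'a)) set \<Rightarrow> ('i \<times> 'a) set topology" where
  "colimit X I M = topology (\<lambda>U.
     U \<subseteq> topspace (sum_topology X I) // colimit_rel X I M \<and> openin (sum_topology X I) (\<Union>U))"

lemma equiv_colimit_rel: "equiv (topspace (sum_topology X I)) (colimit_rel X I M)"
proof (rule equivI)
  show "refl_on (topspace (sum_topology X I)) (colimit_rel X I M)"
    unfolding refl_on_def colimit_rel_def by (simp add: equivclp_def)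
  show "colimit_rel X I M \<subseteq> topspace (sum_topology X I) \<times> topspace (sum_topology X I)"
    unfolding colimit_rel_def by blast
  show "sym (colimit_rel X I M)"
    unfolding sym_def colimit_rel_def by (blast intro: equivclp_sym)
  show "trans (colimit_rel X I M)"
    unfolding trans_def colimit_rel_def by (blast intro: equivclp_trans)
qed

lemma openin_colimit:
  "openin (colimit X I M) U \<longleftrightarrow>
     U \<subseteq> topspace (sum_topology X I) // colimit_rel X I M \<and> openin (sum_topology X I) (\<Union>U)"
proof -
  let ?Q = "topspace (sum_topology X I) // colimit_rel X I M"
  have disj: "\<Union>(U \<inter> V) = \<Union>U \<inter> \<Union>V" if "U \<subseteq> ?Q" "V \<subseteq> ?Q" for U V
  proof
    show "\<Union>U \<inter> \<Union>V \<subseteq> \<Union>(U \<inter> V)"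
    proof
      fix x assume "x \<in> \<Union>U \<inter> \<Union>V"
      then obtain A B where AB: "A \<in> U" "B \<in> V" "x \<in> A" "x \<in> B" by blast
      have "A = B \<or> A \<inter> B = {}"
        by (rule quotient_disj[OF equiv_colimit_rel]) (use AB that in blast)+
      then show "x \<in> \<Union>(U \<inter> V)" using AB by blast
    qed
  qed blast
  have "istopology (\<lambda>U. U \<subseteq> ?Q \<and> openin (sum_topology X I) (\<Union>U))"
    unfolding istopology_def
  proof (intro conjI allI impI)
    fix K assume K: "\<forall>U\<in>K. U \<subseteq> ?Q \<and> openin (sum_topology X I) (\<Union>U)"
    then show "\<Union>K \<subseteq> ?Q" by blast
    have *: "\<Union>(\<Union>K) = \<Union>(Union ` K)" by blast
    show "openin (sum_topology X I) (\<Union>(\<Union>K))"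
      unfolding * by (rule openin_Union) (use K in blast)
  next
    fix S T assume "S \<subseteq> ?Q \<and> openin (sum_topology X I) (\<Union>S)"
      and "T \<subseteq> ?Q \<and> openin (sum_topology X I) (\<Union>T)"
    then show "openin (sum_topology X I) (\<Union>(S \<inter> T))"
      by (metis disj openin_Int)
  qed blast
  then show ?thesis
    by (simp only: colimit_def topology_inverse')
qed

lemma topspace_colimit:
  "topspace (colimit X I M) = topspace (sum_topology X I) // colimit_rel X I M"
proof
  have "openin (colimit X I M) (topspace (sum_topology X I) // colimit_rel X I M)"
    unfolding openin_colimit Union_quotient[OF equiv_colimit_rel] by blast
  then show "topspace (sum_topology X I) // colimit_rel X I M \<subseteq> topspace (colimit X I M)"
    by (rule openin_subset)
  show "topspace (colimit X I M) \<subseteq> topspace (sum_topology X I) // colimit_rel X I M"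
    using openin_topspace[of "colimit X I M"] unfolding openin_colimit by blast
qed

lemma quotient_map_colimit:
  "quotient_map (sum_topology X I) (colimit X I M) (\<lambda>p. colimit_rel X I M `` {p})"
proof -
  let ?T = "topspace (sum_topology X I)" and ?R = "colimit_rel X I M"
  have *: "{p \<in> ?T. ?R `` {p} \<in> U} = \<Union>U" if U: "U \<subseteq> ?T // ?R" for U
  proof (intro equalityI subsetI)
    fix p assume "p \<in> {p \<in> ?T. ?R `` {p} \<in> U}"
    then show "p \<in> \<Union>U"
      using equiv_class_self[OF equiv_colimit_rel] by blast
  next
    fix p assume "p \<in> \<Union>U"
    then obtain C where C: "C \<in> U" "p \<in> C" by blast
    then have "C \<in> ?T // ?R" using U by blast
    then obtain q where q: "C = ?R `` {q}" by (rule quotientE)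
    then have qp: "(q, p) \<in> ?R" using C by blast
    then have "p \<in> ?T" unfolding colimit_rel_def by blast
    moreover have "?R `` {p} = C"
      unfolding q by (rule equiv_class_eq[OF equiv_colimit_rel, OF qp, symmetric])
    ultimately show "p \<in> {p \<in> ?T. ?R `` {p} \<in> U}" using C by blast
  qed
  show ?thesis
    unfolding quotient_map_def topspace_colimit openin_colimit
  proof (intro conjI allI impI)
    show "(\<lambda>p. ?R `` {p}) ` ?T = ?T // ?R"
      unfolding quotient_def by blast
  next
    fix U assume U: "U \<subseteq> ?T // ?R"
    show "openin (sum_topology X I) {p \<in> ?T. ?R `` {p} \<in> U} \<longleftrightarrow>
        U \<subseteq> ?T // ?R \<and> openin (sum_topology X I) (\<Union>U)"
      unfolding *[OF U] using U by blast
  qed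
qed


section \<open>The virtual dual complex\<close>

definition virtual_dual_complex ::
    "nat \<Rightarrow> nat \<Rightarrow> nat \<Rightarrow> (wgraph \<times> (nat \<Rightarrow> real)) set topology" where
  "virtual_dual_complex g n d =
     colimit kappa (stable_graphs g n d)
       {(G', G, extend_metric G \<phi>) | G \<phi> G'. morphism g n d G \<phi> G'}"


section \<open>Deformation retractions\<close>

text \<open>
  The homotopy must fix the subspace \<open>A\<close> throughout. If \<open>g = 0\<close>, \<open>n \<le> 1\<close> and \<open>d = 1\<close>, the
  only stable graph is a single vertex without edges, so the virtual dual complex is empty and does
  not retract onto a point; the library's \<open>contractible_space\<close> does hold of the empty space.
\<close>

definition deformation_retraction_onto ::
    "'a topology \<Rightarrow> 'a set \<Rightarrow> ('a \<times> real \<Rightarrow> 'a) \<Rightarrow> bool" where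
  "deformation_retraction_onto X A H \<longleftrightarrow>
     A \<subseteq> topspace X \<and>
     continuous_map (prod_topology X (top_of_set {0..1})) X H \<and>
     (\<forall>x\<in>topspace X. H (x, 0) = x \<and> H (x, 1) \<in> A) \<and>
     (\<forall>a\<in>A. \<forall>t\<in>{0..1}. H (a, t) = a)"

end

theory Submission
  imports Defs
begin

text \<open>
  Call a vertex a unit leaf if it has genus 0, degree 1, valence 1 and no marking. A stable graph \<open>G\<close>
  with an edge can be sprouted: a vertex that is not a unit leaf trades its degree \<open>\<delta>\<close> for \<open>\<delta>\<close> new unit
  leaves attached to it. The result \<open>K\<close> is again stable (a vertex of genus 0 that becomes unstable
  would have had to be a unit leaf), all its degree sits on \<open>d\<close> unit leaves, and contracting the new
  edges gives a morphism from \<open>K\<close> to \<open>G\<close>. So every point of the virtual dual complex is represented by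
  a metric on a sprouted graph \<open>K\<close>, zero on the new edges. The homotopy moves this metric along a
  straight line inside the simplex of \<open>K\<close> to the metric giving length \<open>1/d\<close> to the edge at each unit
  leaf. At the end all other edges have length 0; contracting them leaves a star with \<open>d\<close> unit leaves
  around one vertex of genus \<open>g\<close> carrying all markings, so the end point does not depend on the
  starting point. This point is fixed throughout, because its own line is constant.

  The homotopy must be compatible with the identifications of the colimit
  (\<open>slide_morphism\<close>). If an edge that ends in no unit leaf is contracted, then contracting it also
  in \<open>K\<close> gives the sprouting of the contracted graph
  (\<open>complete_sprouting_contract_inner\<close>). If the edge of a unit leaf is contracted, the degree of the
  leaf passes to its neighbour, which sprouts it again: \<open>K\<close> itself is the sprouting of the contracted
  graph (\<open>complete_sprouting_contract_leaf\<close>). Both rest on the fact that contractions of stable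
  graphs never create a unit leaf (\<open>unit_leaf_contract\<close>) and on the uniqueness of sproutings up to
  isomorphism (\<open>sprouting_unique\<close>), which is also what identifies any two stars. Continuity holds on
  each simplex and descends to the colimit, as the product of a quotient map with the compact
  interval is a quotient map.

  For \<open>g = n = 0\<close> and \<open>d = 2\<close> the star degenerates: its centre would be unstable, and the end point is
  a single edge joining two unit leaves. The length of an edge at time 1 is therefore taken to be
  the total degree of its ends divided by \<open>d\<close>.
\<close>

section \<open>Valence, stability and unit leaves\<close>

lemma multigraph_edge_cases:
  assumes "is_multigraph G" "e \<in> edges G"
  obtains p where "p \<in> verts G" "ends G e = {p}" "is_loop G e"
  | p q where "p \<in> verts G" "q \<in> verts G" "p < q" "ends G e = {p, q}" "\<not> is_loop G e"
proof -
  have sub: "ends G e \<subseteq> verts G" and c: "card (ends G e) = 1 \<or> card (ends G e) = 2"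
    using assms by (auto simp: is_multigraph_def)
  from c show ?thesis
  proof
    assume 1: "card (ends G e) = 1"
    then obtain p where "ends G e = {p}" by (auto simp: card_1_singleton_iff)
    then show ?thesis using that(1) sub 1 by (auto simp: is_loop_def)
  next
    assume 2: "card (ends G e) = 2"
    then obtain p q where pq: "ends G e = {p, q}" "p \<noteq> q" by (auto simp: card_2_iff)
    then have "p < q \<or> q < p" by auto
    then show ?thesis using that(2)[of p q] that(2)[of q p] sub 2 pq
      by (auto simp: is_loop_def insert_commute)
  qed
qed

definition incidence :: "wgraph \<Rightarrow> nat \<Rightarrow> nat \<Rightarrow> nat" where
  "incidence G v e = (if v \<in> ends G e then if is_loop G e then 2 else 1 else 0)"

lemma multigraph_edge_ends:
  assumes "is_multigraph G" "e \<in> edges G"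
  obtains p q where "ends G e = {p, q}" "p \<le> q"
  using assms
proof (rule multigraph_edge_cases)
  fix p assume "ends G e = {p}" then show thesis using that[of p p] by simp
next
  fix p q assume "ends G e = {p, q}" "p < q" then show thesis using that[of p q] by simp
qed

lemma incidence_ends:
  assumes "ends G e = {p, q}"
  shows "incidence G v e = of_bool (v = p) + of_bool (v = q)"
  using assms by (cases "p = q") (auto simp: incidence_def is_loop_def)

lemma valence_eq_sum_incidence:
  assumes "finite (edges G)"
  shows "valence G v = (\<Sum>e\<in>edges G. incidence G v e)"
proof -
  have "(\<Sum>e\<in>edges G. incidence G v e) =
      (\<Sum>e\<in>edges G. if v \<in> ends G e then (if is_loop G e then 2 else 1) else 0)"
    by (simp add: incidence_def)
  also have "\<dots> = valence G v"
    unfolding valence_def by (subst sum.inter_filter[OF assms, symmetric]) simp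
  finally show ?thesis ..
qed

lemma valence_pos:
  assumes "finite (edges G)" "e \<in> edges G" "v \<in> ends G e"
  shows "1 \<le> valence G v"
proof -
  have "1 \<le> incidence G v e" using assms by (simp add: incidence_def)
  also have "\<dots> \<le> valence G v"
    unfolding valence_eq_sum_incidence[OF assms(1)] using assms by (intro member_le_sum) auto
  finally show ?thesis .
qed

lemma valence_one_iff:
  assumes "finite (edges G)"
  shows "valence G v = 1 \<longleftrightarrow>
    (\<exists>e\<in>edges G. v \<in> ends G e \<and> \<not> is_loop G e \<and> (\<forall>e'\<in>edges G. v \<in> ends G e' \<longrightarrow> e' = e))"
  unfolding valence_eq_sum_incidence[OF assms] sum_eq_1_iff[OF assms]
  by (auto simp: incidence_def split: if_splits)

text \<open>
  Stability reads \<open>special n G v \<ge> 3\<close> at vertices of degree 0. This number is additive under merging two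
  vertices, up to the 2 half-edges of the contracted edge, and invariant under contracting a loop.
\<close>

definition special :: "nat \<Rightarrow> wgraph \<Rightarrow> nat \<Rightarrow> nat" where
  "special n G v = 2 * genus G v + valence G v + card {i \<in> {1..n}. mark G i = v}"

lemma stable_iff_special:
  "stable n G \<longleftrightarrow> (\<forall>v\<in>verts G. deg G v = 0 \<longrightarrow> 3 \<le> special n G v)"
proof -
  have "2 * int (genus G v) - 2 + int (valence G v) + int (card {i \<in> {1..n}. mark G i = v}) > 0
     \<longleftrightarrow> 3 \<le> special n G v" for v
    unfolding special_def by linarith
  then show ?thesis unfolding stable_def by simp
qed

definition unit_leaf :: "nat \<Rightarrow> wgraph \<Rightarrow> nat \<Rightarrow> bool" where
  "unit_leaf n G v \<longleftrightarrow> v \<in> verts G \<and> genus G v = 0 \<and> deg G v = 1 \<and> valence G v = 1 \<and>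
     (\<forall>i\<in>{1..n}. mark G i \<noteq> v)"

text \<open>
  At a vertex with an edge, 1 is the least value of \<open>special\<close>, and it forces genus 0, valence 1 and the
  absence of markings.
\<close>

lemma unit_leaf_iff_special:
  assumes "1 \<le> valence G v"
  shows "unit_leaf n G v \<longleftrightarrow> v \<in> verts G \<and> deg G v = 1 \<and> special n G v = 1"
proof -
  have "special n G v = 1 \<longleftrightarrow>
      genus G v = 0 \<and> valence G v = 1 \<and> card {i \<in> {1..n}. mark G i = v} = 0"
    using assms unfolding special_def by linarith
  then show ?thesis by (auto simp: unit_leaf_def)
qed

lemma connected_valence_pos:
  assumes G: "is_multigraph G" "is_connected G" and "edges G \<noteq> {}" "v \<in> verts G"
  shows "1 \<le> valence G v"
proof -
  have fin: "finite (edges G)" using G by (simp add: is_multigraph_def)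
  have "\<exists>e\<in>edges G. v \<in> ends G e"
  proof -
    obtain e where e: "e \<in> edges G" using assms by blast
    then obtain p where p: "p \<in> ends G e" "p \<in> verts G"
      using G(1) by (elim multigraph_edge_cases) auto
    then have "(v, p) \<in> (adjacency G)\<^sup>*" using G assms by (auto simp: is_connected_def)
    then show ?thesis
    proof (cases rule: converse_rtranclE)
      case base then show ?thesis using e p by blast
    next
      case (step y) then show ?thesis by (auto simp: adjacency_def)
    qed
  qed
  then show ?thesis using valence_pos[OF fin] by blast
qed


section \<open>Contracting an edge of a stable graph\<close>

interpretation cycles: vector_space "\<lambda>(a::rat) (c::nat \<Rightarrow> rat) e. a * c e"
  by unfold_locales (auto simp: fun_eq_iff algebra_simps)

lemma dim_H1_eq: "dim_H1 G = cycles.dim (H1 G)"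
  unfolding dim_H1_def ..

lemma subspace_H1: "cycles.subspace (H1 G)"
  unfolding cycles.subspace_def H1_def
  by (auto simp: algebra_simps sum.distrib sum_distrib_left[symmetric])

lemma boundary_coeff_loop: "is_loop G e \<Longrightarrow> boundary_coeff G v e = 0"
  by (auto simp: is_loop_def boundary_coeff_def card_1_singleton_iff)

lemma boundary_coeff_ends:
  assumes "ends G e = {p, q}"
  shows "boundary_coeff G v e = (if p \<le> q then 1 else -1) * (of_bool (v = q) - of_bool (v = p))"
  using assms by (auto simp: boundary_coeff_def max_def min_def)

lemma boundary_coeff_outside: 
  assumes "is_multigraph G" "e \<in> edges G" "v \<notin> ends G e" 
  shows "boundary_coeff G v e = 0"
  using assms(1,2) by (rule multigraph_edge_cases) (use assms(3) in \<open>auto simp: boundary_coeff_def\<close>)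

lemma sum_apply: "(\<Sum>i\<in>A. f i) x = (\<Sum>i\<in>A. f i x)" for f :: "_ \<Rightarrow> _ \<Rightarrow> _::comm_monoid_add"
  by (induction A rule: infinite_finite_induct) auto

lemma contract_loop_simps:
  assumes "is_loop G e"
  shows "verts (contract e G) = verts G" "edges (contract e G) = edges G - {e}"
    "ends (contract e G) = ends G" 
    "genus (contract e G) v = (if v \<in> ends G e then genus G v + 1 else genus G v)"
    "deg (contract e G) = deg G" "mark (contract e G) = mark G"
    "is_loop (contract e G) = is_loop G"
  using assms by (auto simp: contract_def contract_loop_def is_loop_def fun_eq_iff)

text \<open>
  A loop is a cycle by itself, and the cycles avoiding it are those of the contracted graph. So a
  basis of the latter is completed by the indicator of the loop.
\<close>

lemma dim_H1_contract_loop: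
  assumes "is_multigraph G" "e \<in> edges G" "is_loop G e"
  shows "dim_H1 G = dim_H1 (contract e G) + 1"
proof -
  have fin: "finite (edges G)" using assms by (simp add: is_multigraph_def)
  let ?b = "\<lambda>e'. of_bool (e' = e) :: rat"
  have bc: "boundary_coeff (contract e G) = boundary_coeff G"
    by (auto simp: boundary_coeff_def contract_loop_simps[OF assms(3)] fun_eq_iff)
  have H1': "c \<in> H1 (contract e G) \<longleftrightarrow> c \<in> H1 G \<and> c e = 0" for c
  proof (cases "c e = 0")
    case True
    then have "(\<Sum>e'\<in>edges G - {e}. c e' * boundary_coeff G v e') =
         (\<Sum>e'\<in>edges G. c e' * boundary_coeff G v e')" for v
      by (intro sum.mono_neutral_left) (use fin in auto)
    then show ?thesis using True by (auto simp: H1_def contract_loop_simps[OF assms(3)] bc)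
  qed (use assms in \<open>auto simp: H1_def contract_loop_simps\<close>)
  have b: "?b \<in> H1 G"
    using assms by (auto simp: H1_def of_bool_def if_distrib[of "\<lambda>x. x * _"] boundary_coeff_loop[OF assms(3)] cong: if_cong)
  obtain B where B: "B \<subseteq> H1 (contract e G)" "cycles.independent B"
      "H1 (contract e G) \<subseteq> cycles.span B" "card B = cycles.dim (H1 (contract e G))"
    using cycles.basis_exists .
  have sB: "cycles.span B = H1 (contract e G)"
    using cycles.span_minimal[OF B(1) subspace_H1] B(3) by blast
  have "finite B"
  proof -
    let ?T = "(\<lambda>e0 e'. of_bool (e' = e0) :: rat) ` edges G"
    have "B \<subseteq> cycles.span ?T"
    proof
      fix c assume "c \<in> B"
      then have c: "c \<in> H1 G" using B(1) H1' by auto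
      have "c = (\<Sum>e0\<in>edges G. (\<lambda>e'. c e0 * of_bool (e' = e0)))"
      proof
        fix e'
        have "(\<Sum>e0\<in>edges G. (\<lambda>e'. c e0 * of_bool (e' = e0))) e' = (\<Sum>e0\<in>edges G. if e' = e0 then c e0 else 0)"
          by (simp add: sum_apply if_distrib of_bool_def cong: if_cong)
        also have "\<dots> = c e'" using c fin by (simp add: H1_def)
        finally show "c e' = (\<Sum>e0\<in>edges G. (\<lambda>e'. c e0 * of_bool (e' = e0))) e'" ..
      qed
      also have "\<dots> \<in> cycles.span ?T"
        by (intro cycles.span_sum cycles.span_scale cycles.span_base) auto
      finally show "c \<in> cycles.span ?T" .
    qed
    then show ?thesis using cycles.independent_span_bound[OF _ B(2)] fin by blast
  qed
  have nb: "?b \<notin> cycles.span B" unfolding sB H1' by simp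
  then have "cycles.independent (insert ?b B)"
    using cycles.independent_insertI[OF _ B(2)] by blast
  moreover have "insert ?b B \<subseteq> H1 G" using b B(1) H1' by auto
  moreover have "H1 G \<subseteq> cycles.span (insert ?b B)"
  proof
    fix c assume c: "c \<in> H1 G"
    have "(\<lambda>e'. c e * ?b e') \<in> H1 G" using cycles.subspace_scale[OF subspace_H1 b] by blast
    then have "c - (\<lambda>e'. c e * ?b e') \<in> H1 G" using cycles.subspace_diff[OF subspace_H1 c] by blast
    then have "c - (\<lambda>e'. c e * ?b e') \<in> cycles.span B" unfolding sB H1' by simp
    then show "c \<in> cycles.span (insert ?b B)"
      unfolding cycles.span_insert by blast
  qed
  ultimately have "cycles.dim (H1 G) = card (insert ?b B)"
    using cycles.basis_card_eq_dim by metis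
  also have "\<dots> = card B + 1"
    using card.insert[OF \<open>finite B\<close>, of ?b] nb cycles.span_base[of ?b B] by linarith
  finally show ?thesis using B(4) by (simp add: dim_H1_eq)
qed

text \<open>
  The effect on vertices of contracting an edge with ends \<open>u < v\<close>.
\<close>

definition collapse :: "nat \<Rightarrow> nat \<Rightarrow> nat \<Rightarrow> nat" where
  "collapse u v x = (if x = v then u else x)"

text \<open>
  Contracting an edge with two distinct ends, named so that \<open>v\<close> is merged into \<open>u\<close>.
\<close>

locale nonloop =
  fixes G :: wgraph and e u v :: nat
  assumes multigraph: "is_multigraph G" and edge: "e \<in> edges G"
    and ends_e: "ends G e = {u, v}" and less: "u < v"
begin

abbreviation r where "r \<equiv> collapse u v"

lemma not_loop: "\<not> is_loop G e"
  using ends_e less by (simp add: is_loop_def)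

lemma contract_simps:
  "verts (contract e G) = verts G - {v}" "edges (contract e G) = edges G - {e}"
  "ends (contract e G) e' = r ` ends G e'" 
  "genus (contract e G) x = (if x = u then genus G u + genus G v else genus G x)"
  "deg (contract e G) x = (if x = u then deg G u + deg G v else deg G x)"
  "mark (contract e G) i = r (mark G i)"
proof -
  have "Max (ends G e) = v" "Min (ends G e) = u" using ends_e less by auto
  moreover have "r = (\<lambda>x. if x = v then u else x)" by (rule ext) (simp add: collapse_def)
  ultimately show "verts (contract e G) = verts G - {v}" "edges (contract e G) = edges G - {e}"
  "ends (contract e G) e' = r ` ends G e'" 
  "genus (contract e G) x = (if x = u then genus G u + genus G v else genus G x)"
  "deg (contract e G) x = (if x = u then deg G u + deg G v else deg G x)"
  "mark (contract e G) i = r (mark G i)"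
    using not_loop by (auto simp: contract_def contract_nonloop_def Let_def)
qed

lemma uv: "u \<in> verts G" "v \<in> verts G" "u \<noteq> v" and fin: "finite (edges G)" "finite (verts G)"
  using multigraph edge ends_e less by (auto simp: is_multigraph_def)

lemma verts_contract: "verts (contract e G) = r ` verts G"
  using uv by (auto simp: contract_simps collapse_def image_iff)

text \<open>
  Merging \<open>v\<close> into \<open>u\<close> adds the boundary coefficients at \<open>v\<close> to those at \<open>u\<close>, up to the sign \<open>s\<close>: edges
  are oriented by the names of their ends, and the order of these may change.
\<close>

lemma boundary_contract:
  assumes "e' \<in> edges G"
  obtains s :: rat where "s * s = 1" 
    "\<forall>x. x \<noteq> v \<longrightarrow> boundary_coeff (contract e G) x e' = s * (boundary_coeff G x e' + of_bool (x = u) * boundary_coeff G v e')"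
proof -
  obtain p q where pq: "ends G e' = {p, q}" "p \<le> q"
    using multigraph assms by (rule multigraph_edge_ends)
  then have E: "ends (contract e G) e' = {r p, r q}" by (simp add: contract_simps)
  define s :: rat where "s = (if r p \<le> r q then 1 else -1)"
  have "boundary_coeff (contract e G) x e' = s * (boundary_coeff G x e' + of_bool (x = u) * boundary_coeff G v e')" if "x \<noteq> v" for x
    unfolding boundary_coeff_ends[of "contract e G", OF E] boundary_coeff_ends[of G, OF pq(1)] 
    using pq(2) that less by (auto simp: s_def collapse_def)
  then show ?thesis using that[of s] by (auto simp: s_def)
qed

text \<open>
  Forgetting the contracted edge, with a sign on the others, is a linear isomorphism of cycle
  spaces. It is injective since the coefficient of the forgotten edge is determined by the boundary
  condition at \<open>v\<close>; the same condition defines the inverse.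
\<close>

lemma dim_H1_contract: "dim_H1 (contract e G) = dim_H1 G"
proof -
  let ?G' = "contract e G"
  have "\<exists>s. \<forall>e'\<in>edges G. s e' * s e' = (1::rat) \<and>
    (\<forall>x. x \<noteq> v \<longrightarrow> boundary_coeff ?G' x e' = s e' * (boundary_coeff G x e' + of_bool (x = u) * boundary_coeff G v e'))"
    by (rule bchoice) (meson boundary_contract)
  then obtain s where ss: "\<And>e'. e' \<in> edges G \<Longrightarrow> s e' * s e' = (1::rat)"
    and s: "\<And>e' x. e' \<in> edges G \<Longrightarrow> x \<noteq> v \<Longrightarrow>
       boundary_coeff ?G' x e' = s e' * (boundary_coeff G x e' + of_bool (x = u) * boundary_coeff G v e')"
    by blast
  have be: "boundary_coeff G x e = of_bool (x = v) - of_bool (x = u)" for x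
    using ends_e less by (simp add: boundary_coeff_def max_def min_def)
  define D where "D c x = (\<Sum>e'\<in>edges G - {e}. c e' * boundary_coeff G x e')" for c :: "nat \<Rightarrow> rat" and x
  define T where "T c e' = (if e' \<in> edges G - {e} then s e' * c e' else 0)" for c :: "nat \<Rightarrow> rat" and e'
  have HG: "c \<in> H1 G \<longleftrightarrow> (\<forall>e'. e' \<notin> edges G \<longrightarrow> c e' = 0) \<and>
      (\<forall>x\<in>verts G. D c x + c e * (of_bool (x = v) - of_bool (x = u)) = 0)" for c
    unfolding H1_def D_def by (simp add: sum.remove[OF fin(1) edge] be add.commute)
  have TD: "(\<Sum>e'\<in>edges ?G'. T c e' * boundary_coeff ?G' x e') = D c x + of_bool (x = u) * D c v"
    if "x \<noteq> v" for c x
  proof -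
    have "(\<Sum>e'\<in>edges ?G'. T c e' * boundary_coeff ?G' x e') =
       (\<Sum>e'\<in>edges G - {e}. (s e' * s e') * (c e' * (boundary_coeff G x e' + of_bool (x = u) * boundary_coeff G v e')))"
      by (rule sum.cong) (auto simp: contract_simps T_def s that)
    also have "\<dots> = (\<Sum>e'\<in>edges G - {e}. (c e' * (boundary_coeff G x e' + of_bool (x = u) * boundary_coeff G v e')))"
      by (rule sum.cong) (auto simp: ss)
    also have "\<dots> = D c x + of_bool (x = u) * D c v"
      by (simp add: D_def algebra_simps sum.distrib sum_distrib_left)
    finally show ?thesis .
  qed
  have H1': "H1 ?G' = T ` H1 G"
  proof (intro equalityI subsetI)
    fix c' assume c': "c' \<in> H1 ?G'"
    define c0 where "c0 e' = (if e' \<in> edges G - {e} then s e' * c' e' else 0)" for e'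
    define c where "c = c0(e := - D c0 v)"
    have Dc: "D c x = D c0 x" for x unfolding D_def c_def by (rule sum.cong) auto
    have ce: "c e = - D c0 v" by (simp add: c_def)
    have Tc: "T c = c'"
    proof
      fix e' 
      have "s e' * (s e' * c' e') = c' e'" if "e' \<in> edges G" using ss[OF that] by (metis mult.assoc mult_1)
      then show "T c e' = c' e'" using c' 
        by (auto simp: T_def c_def c0_def H1_def contract_simps)
    qed
    have "c \<in> H1 G" unfolding HG
    proof (intro conjI allI impI ballI)
      fix x assume x: "x \<in> verts G"
      show "D c x + c e * (of_bool (x = v) - of_bool (x = u)) = 0"
      proof (cases "x = v")
        case True then show ?thesis using uv by (simp add: Dc) (simp add: c_def)
      next
        case False
        then have "D c x + of_bool (x = u) * D c v = 0" 
          using TD[OF False, of c] c' x by (simp add: Tc H1_def contract_simps)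
        then show ?thesis using False ce by (auto simp: Dc add_eq_0_iff2 split: if_splits)
      qed
    qed (use edge in \<open>auto simp: c_def c0_def\<close>)
    then show "c' \<in> T ` H1 G" using Tc by blast
  next
    fix c' assume "c' \<in> T ` H1 G"
    then obtain c where c: "c \<in> H1 G" "c' = T c" by blast
    have *: "D c x + c e * (of_bool (x = v) - of_bool (x = u)) = 0" if "x \<in> verts G" for x
      using c(1) that unfolding HG by blast
    show "c' \<in> H1 ?G'"
      unfolding H1_def mem_Collect_eq
    proof (intro conjI allI impI ballI)
      fix x assume "x \<in> verts ?G'"
      then have x: "x \<in> verts G" "x \<noteq> v" by (auto simp: contract_simps)
      show "(\<Sum>e'\<in>edges ?G'. c' e' * boundary_coeff ?G' x e') = 0"
        unfolding c(2) TD[OF x(2)] using *[OF x(1)] *[OF uv(2)] x uv by (auto simp: of_bool_def split: if_splits)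
    qed (auto simp: c T_def contract_simps)
  qed
  have "inj_on T (H1 G)"
  proof (rule inj_onI)
    fix c1 c2 assume c: "c1 \<in> H1 G" "c2 \<in> H1 G" "T c1 = T c2"
    have 1: "c1 e' = c2 e'" if "e' \<in> edges G - {e}" for e'
    proof -
      have "s e' * c1 e' = s e' * c2 e'" using fun_cong[OF c(3), of e'] that by (simp add: T_def)
      moreover have "s e' \<noteq> 0" using ss[of e'] that by auto
      ultimately show ?thesis by simp
    qed
    then have "D c1 v = D c2 v" by (simp add: D_def)
    moreover have "D c1 v + c1 e = 0" "D c2 v + c2 e = 0"
      using c(1,2) uv unfolding HG by (auto dest!: bspec[of _ _ v])
    ultimately have 2: "c1 e = c2 e" by simp
    show "c1 = c2"
    proof
      fix e' show "c1 e' = c2 e'"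
        using 1[of e'] 2 c(1,2) unfolding HG by (cases "e' \<in> edges G"; cases "e' = e") auto
    qed
  qed
  moreover interpret T: Vector_Spaces.linear "\<lambda>(a::rat) (c::nat \<Rightarrow> rat) e. a * c e" "\<lambda>(a::rat) (c::nat \<Rightarrow> rat) e. a * c e" T
    by unfold_locales (auto simp: T_def fun_eq_iff algebra_simps)
  obtain B where B: "B \<subseteq> H1 G" "cycles.independent B" "H1 G \<subseteq> cycles.span B" "card B = cycles.dim (H1 G)"
    using cycles.basis_exists .
  moreover have sB: "cycles.span B = H1 G"
    using cycles.span_minimal[OF B(1) subspace_H1] B(3) by blast
  ultimately have "cycles.independent (T ` B)" "card (T ` B) = card B"
    using T.dependent_inj_imageD[of B] card_image[of T B] inj_on_subset[of T "H1 G" B] by auto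
  moreover have "H1 ?G' \<subseteq> cycles.span (T ` B)" unfolding T.span_image sB H1' ..
  moreover have "T ` B \<subseteq> H1 ?G'" using B(1) H1' by blast
  ultimately show ?thesis
    unfolding dim_H1_eq using cycles.basis_card_eq_dim[of "T ` B"] B(4) by metis
qed

lemma connected_contract: 
  assumes "is_connected G" shows "is_connected (contract e G)"
proof -
  have "(r x, r y) \<in> (adjacency (contract e G))\<^sup>*" if "(x, y) \<in> (adjacency G)\<^sup>*" for x y
    using that
  proof induction
    case (step y z)
    then obtain e' where e': "e' \<in> edges G" "ends G e' = {y, z}" by (auto simp: adjacency_def)
    have "r y = r z \<or> (r y, r z) \<in> adjacency (contract e G)"
    proof (cases "e' = e")
      case True then show ?thesis using e' ends_e by (auto simp: collapse_def doubleton_eq_iff)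
    next
      case False then show ?thesis using e' by (auto simp: adjacency_def contract_simps)
    qed
    then show ?case using step.IH by (metis rtrancl.rtrancl_into_rtrancl)
  qed auto
  then show ?thesis using assms unfolding is_connected_def verts_contract by blast
qed

lemma multigraph_contract: "is_multigraph (contract e G)"
proof -
  have "card (r ` ends G e') \<in> {1, 2}" if e': "e' \<in> edges G" for e'
    using multigraph e' by (rule multigraph_edge_cases) (auto simp: card_insert_if)
  then show ?thesis 
    using multigraph verts_contract unfolding is_multigraph_def
    by (auto simp: contract_simps(2,3) intro!: imageI)
qed

lemma incidence_contract:
  assumes "x \<noteq> v" "e' \<in> edges G"
  shows "incidence (contract e G) x e' = incidence G x e' + of_bool (x = u) * incidence G v e'"
proof -
  obtain p q where pq: "ends G e' = {p, q}"
    using multigraph assms(2) by (rule multigraph_edge_ends)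
  then have "ends (contract e G) e' = {r p, r q}" by (simp add: contract_simps)
  then show ?thesis using uv assms(1) pq by (simp add: incidence_ends collapse_def)
qed

lemma valence_contract:
  assumes "x \<noteq> v"
  shows "valence (contract e G) x + of_bool (x = u) * 2 = valence G x + of_bool (x = u) * valence G v"
proof -
  have fin': "finite (edges (contract e G))" using fin by (simp add: contract_simps)
  have "valence (contract e G) x = (\<Sum>e'\<in>edges G - {e}. incidence G x e' + of_bool (x = u) * incidence G v e')"
    unfolding valence_eq_sum_incidence[OF fin'] 
    by (rule sum.cong) (auto simp: incidence_contract assms contract_simps)
  moreover have "valence G x + of_bool (x = u) * valence G v = 
      (\<Sum>e'\<in>edges G. incidence G x e' + of_bool (x = u) * incidence G v e')"
    unfolding valence_eq_sum_incidence[OF fin(1)] by (simp add: sum.distrib sum_distrib_left)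
  moreover have "\<dots> = incidence G x e + of_bool (x = u) * incidence G v e + (\<Sum>e'\<in>edges G - {e}. incidence G x e' + of_bool (x = u) * incidence G v e')"
    by (rule sum.remove[OF fin(1) edge])
  moreover have "incidence G x e + of_bool (x = u) * incidence G v e = of_bool (x = u) * 2"
    using assms uv ends_e not_loop by (auto simp: incidence_def)
  ultimately show ?thesis by simp
qed

lemma special_contract:
  assumes "x \<noteq> v"
  shows "special n (contract e G) x + of_bool (x = u) * 2 = special n G x + of_bool (x = u) * special n G v"
proof -
  have "{i \<in> {1..n}. r (mark G i) = x} = {i \<in> {1..n}. mark G i = x} \<union> (if x = u then {i \<in> {1..n}. mark G i = v} else {})"
    using assms by (auto simp: collapse_def split: if_splits)
  moreover have "{i \<in> {1..n}. mark G i = x} \<inter> {i \<in> {1..n}. mark G i = v} = {}" using assms by auto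
  ultimately have "card {i \<in> {1..n}. r (mark G i) = x} = card {i \<in> {1..n}. mark G i = x} + of_bool (x = u) * card {i \<in> {1..n}. mark G i = v}"
    by (cases "x = u") (simp_all add: card_Un_disjoint)
  then show ?thesis using valence_contract[OF assms]
    by (auto simp: special_def contract_simps split: if_splits)
qed

lemma sum_contract: 
  fixes f :: "nat \<Rightarrow> nat"
  shows "(\<Sum>x\<in>verts (contract e G). if x = u then f u + f v else f x) = sum f (verts G)"
proof -
  have "u \<in> verts G - {v}" "finite (verts G - {v})" using uv fin by auto
  note * = sum.remove[OF this(2,1)]
  have "(\<Sum>x\<in>verts G - {v}. if x = u then f u + f v else f x) = f u + f v + sum f (verts G - {v} - {u})"
    by (subst *) (auto intro!: sum.cong)
  also have "\<dots> = f v + sum f (verts G - {v})" by (subst *) simp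
  also have "\<dots> = sum f (verts G)" using sum.remove[OF fin(2) uv(2)] by metis
  finally show ?thesis by (simp add: contract_simps)
qed

end

lemma stable_graphsD:
  assumes "G \<in> stable_graphs g n d"
  shows "is_multigraph G" "is_connected G" "finite (edges G)" "finite (verts G)" "verts G \<noteq> {}"
    "mark G ` {1..n} \<subseteq> verts G" "dim_H1 G + (\<Sum>v\<in>verts G. genus G v) = g" "(\<Sum>v\<in>verts G. deg G v) = d"
    "stable n G" "\<And>v. v \<in> verts G \<Longrightarrow> deg G v = 0 \<Longrightarrow> 3 \<le> special n G v"
    "\<And>e. e \<in> edges G \<Longrightarrow> ends G e \<subseteq> verts G"
  using assms by (auto simp: stable_graphs_def gnd_graph_def is_multigraph_def is_connected_def stable_iff_special)

lemma nonloop_edgeI: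
  assumes "is_multigraph G" "e \<in> edges G" "\<not> is_loop G e"
  obtains u v where "nonloop G e u v"
  using assms(1,2) by (rule multigraph_edge_cases) (use assms in \<open>auto simp: nonloop_def\<close>)

lemma special_contract_loop:
  assumes "is_multigraph G" "e \<in> edges G" "is_loop G e"
  shows "special n (contract e G) x = special n G x"
proof -
  have fin: "finite (edges G)" using assms by (simp add: is_multigraph_def)
  have "valence (contract e G) x + incidence G x e = valence G x"
  proof -
    have "valence (contract e G) x = (\<Sum>e'\<in>edges G - {e}. incidence G x e')"
      by (subst valence_eq_sum_incidence)
        (auto simp: contract_loop_simps[OF assms(3)] fin incidence_def cong: if_cong)
    then show ?thesis
      unfolding valence_eq_sum_incidence[OF fin] sum.remove[OF fin assms(2)] by simp
  qed
  then show ?thesis using assms(3)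
    by (auto simp: special_def contract_loop_simps[OF assms(3)] incidence_def)
qed

text \<open>
  The sum of two numbers \<open>special\<close> at least 3, minus 2, is at least 4; hence merging two stable
  vertices of degree 0 gives a stable vertex.
\<close>

lemma contract_stable:
  assumes G: "G \<in> stable_graphs g n d" and e: "e \<in> edges G"
  shows "contract e G \<in> stable_graphs g n d"
proof (cases "is_loop G e")
  case True
  note S = contract_loop_simps[OF True]
  note D = stable_graphsD[OF G]
  obtain p where p: "p \<in> verts G" "ends G e = {p}"
    using True D(1) e by (auto elim: multigraph_edge_cases)
  have "(\<Sum>v\<in>verts G. genus (contract e G) v) = (\<Sum>v\<in>verts G. genus G v + of_bool (v = p))"
    by (rule sum.cong) (auto simp: S p)
  also have "\<dots> = (\<Sum>v\<in>verts G. genus G v) + 1"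
    using p D(4) by (simp add: sum.distrib of_bool_def)
  finally have gen: "(\<Sum>v\<in>verts G. genus (contract e G) v) = (\<Sum>v\<in>verts G. genus G v) + 1" .
  have "adjacency G \<subseteq> (adjacency (contract e G))\<^sup>*"
  proof
    fix z assume "z \<in> adjacency G"
    then obtain e' x y where e': "z = (x, y)" "e' \<in> edges G" "ends G e' = {x, y}" by (auto simp: adjacency_def)
    show "z \<in> (adjacency (contract e G))\<^sup>*"
    proof (cases "e' = e")
      case True then show ?thesis using e' p by (simp add: doubleton_eq_iff)
    next
      case False then show ?thesis using e' by (auto simp: adjacency_def S intro!: r_into_rtrancl)
    qed
  qed
  then have "(adjacency G)\<^sup>* \<subseteq> (adjacency (contract e G))\<^sup>*" by (metis rtrancl_idemp rtrancl_mono)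
  then have "is_connected (contract e G)" using D(2) by (auto simp: is_connected_def S)
  moreover have "is_multigraph (contract e G)" using D(1) by (auto simp: is_multigraph_def S)
  ultimately show ?thesis
    using D(6,7,8,10) gen dim_H1_contract_loop[OF D(1) e True] special_contract_loop[OF D(1) e True]
    by (auto simp: stable_graphs_def gnd_graph_def stable_iff_special S(1,5,6))
next
  case False
  note D = stable_graphsD[OF G]
  obtain u v where "nonloop G e u v" using D(1) e False by (rule nonloop_edgeI)
  then interpret nonloop G e u v .
  have "mark (contract e G) ` {1..n} \<subseteq> verts (contract e G)"
    using D(6) unfolding verts_contract contract_simps(6) by blast
  moreover have "sum (genus (contract e G)) (verts (contract e G)) = sum (genus G) (verts G)"
     "sum (deg (contract e G)) (verts (contract e G)) = sum (deg G) (verts G)"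
    unfolding sum_contract[symmetric] by (rule sum.cong; simp add: contract_simps)+
  moreover have "3 \<le> special n (contract e G) x" if "x \<in> verts (contract e G)" "deg (contract e G) x = 0" for x
    using that special_contract[of x n] D(10)[of x] D(10)[of v] uv by (auto simp: contract_simps split: if_splits)
  ultimately show ?thesis
    using dim_H1_contract connected_contract[OF D(2)] multigraph_contract D(7,8)
    by (auto simp: stable_graphs_def gnd_graph_def stable_iff_special)
qed

text \<open>
  A merged vertex is never a unit leaf. It would have degree 1 and \<open>special\<close> equal to 1, so the two
  merged vertices would have \<open>special\<close> adding up to 3, each at least 1; but one of them has degree 0
  and thus \<open>special\<close> at least 3. A contracted loop leaves positive genus.
\<close>

lemma unit_leaf_contract:
  assumes G: "G \<in> stable_graphs g n d" and e: "e \<in> edges G"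
  shows "unit_leaf n (contract e G) x \<longleftrightarrow> unit_leaf n G x \<and> x \<notin> ends G e"
proof (cases "is_loop G e")
  case True
  note S = contract_loop_simps[OF True]
  note D = stable_graphsD[OF G]
  show ?thesis
  proof (cases "x \<in> ends G e")
    case True then show ?thesis by (simp add: unit_leaf_def S)
  next
    case False
    then have "valence (contract e G) x = valence G x"
      using special_contract_loop[OF D(1) e \<open>is_loop G e\<close>, of n x] by (auto simp: special_def S)
    then show ?thesis using False by (auto simp: unit_leaf_def S)
  qed
next
  case False
  note D = stable_graphsD[OF G]
  obtain u v where "nonloop G e u v" using D(1) e False by (rule nonloop_edgeI)
  then interpret nonloop G e u v .
  consider "x = v" | "x = u" | "x \<noteq> u" "x \<noteq> v" by blast
  then show ?thesis
  proof cases
    case 1 then show ?thesis using ends_e by (simp add: unit_leaf_def contract_simps)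
  next
    case 2
    have "\<not> unit_leaf n (contract e G) u"
    proof
      assume L: "unit_leaf n (contract e G) u"
      then have d1: "deg G u + deg G v = 1" by (simp add: unit_leaf_def contract_simps)
      have "special n (contract e G) u = 1" 
        using L unit_leaf_iff_special[of "contract e G" u n] by (auto simp: unit_leaf_def)
      then have "special n G u + special n G v = 3"
        using special_contract[of u n] uv by simp
      moreover have "1 \<le> special n G u" "1 \<le> special n G v"
        using valence_pos[OF fin(1) edge] ends_e by (auto simp: special_def intro: trans_le_add1 trans_le_add2)
      ultimately show False using D(10)[of u] D(10)[of v] uv d1 by linarith
    qed
    then show ?thesis using 2 ends_e by simp
  next
    case 3
    then have "r y = x \<longleftrightarrow> y = x" for y by (auto simp: collapse_def)
    then show ?thesis using 3 valence_contract[of x] ends_e by (auto simp: unit_leaf_def contract_simps)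
  qed
qed

section \<open>Attaching a leaf\<close>

text \<open>
  The new name exceeds all old ones, so that contracting the new edge keeps the old end and recovers
  the original graph with its labels.
\<close>

definition fresh :: "wgraph \<Rightarrow> nat" where
  "fresh G = Suc (Max (verts G \<union> edges G))"

definition sprout :: "nat \<Rightarrow> wgraph \<Rightarrow> wgraph" where
  "sprout x G = (let z = fresh G in
     \<lparr> verts = insert z (verts G), edges = insert z (edges G), ends = (ends G)(z := {x, z}),
       genus = (genus G)(z := 0), deg = (deg G)(x := deg G x - 1, z := 1), mark = mark G \<rparr>)"

lemma sprout_simps:
  "verts (sprout x G) = insert (fresh G) (verts G)"
  "edges (sprout x G) = insert (fresh G) (edges G)"
  "ends (sprout x G) e = (if e = fresh G then {x, fresh G} else ends G e)"
  "genus (sprout x G) v = (if v = fresh G then 0 else genus G v)"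
  "deg (sprout x G) v = (if v = fresh G then 1 else if v = x then deg G x - 1 else deg G v)"
  "mark (sprout x G) = mark G"
  by (simp_all add: sprout_def Let_def)

locale sprouted =
  fixes G :: wgraph and x z :: nat
  assumes multigraph: "is_multigraph G" and x: "x \<in> verts G" and deg_pos: "0 < deg G x"
    and z_def: "z = fresh G"
begin

lemmas simps = sprout_simps[of x G, folded z_def]

lemma fin: "finite (verts G)" "finite (edges G)"
  using multigraph by (auto simp: is_multigraph_def)

lemma less_z: "y \<in> verts G \<union> edges G \<Longrightarrow> y < z"
  unfolding z_def fresh_def using fin by (simp add: less_Suc_eq_le)

lemma z: "z \<notin> verts G" "z \<notin> edges G" "x \<noteq> z" "x < z"
  using less_z[of z] less_z[of x] x by auto

lemma z_ends: "e \<in> edges G \<Longrightarrow> z \<notin> ends G e"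
  using z multigraph by (auto simp: is_multigraph_def)

lemma multigraph_sprout: "is_multigraph (sprout x G)"
  using multigraph z x by (auto simp: is_multigraph_def simps card_insert_if)

lemma nonloop_sprout: "nonloop (sprout x G) z x z"
  using multigraph_sprout z by (simp add: nonloop_def simps)

text \<open>
  Cycles vanish on the new edge, by the boundary condition at the new leaf; so the two spaces are
  equal as sets of functions.
\<close>

lemma H1_sprout: "H1 (sprout x G) = H1 G"
proof -
  have sum: "(\<Sum>e\<in>edges (sprout x G). c e * boundary_coeff (sprout x G) v e) =
     c z * (of_bool (v = z) - of_bool (v = x)) + (\<Sum>e\<in>edges G. c e * boundary_coeff G v e)" for c v
  proof -
    have "boundary_coeff (sprout x G) v z = of_bool (v = z) - of_bool (v = x)"
      using boundary_coeff_ends[of "sprout x G" z x z] z by (simp add: simps)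
    moreover have "(\<Sum>e\<in>edges G. c e * boundary_coeff (sprout x G) v e) = (\<Sum>e\<in>edges G. c e * boundary_coeff G v e)"
      by (rule sum.cong) (use z in \<open>auto simp: boundary_coeff_def simps\<close>)
    ultimately show ?thesis using fin z by (simp add: simps)
  qed
  have 0: "(\<Sum>e\<in>edges G. c e * boundary_coeff G z e) = 0" for c
    by (rule sum.neutral) (use boundary_coeff_outside[OF multigraph _ z_ends] in auto)
  show ?thesis
  proof (intro equalityI subsetI)
    fix c assume c: "c \<in> H1 (sprout x G)"
    then have all: "\<forall>v\<in>insert z (verts G). c z * (of_bool (v = z) - of_bool (v = x)) + (\<Sum>e\<in>edges G. c e * boundary_coeff G v e) = 0"
      unfolding H1_def sum by (simp add: simps)
    then have "c z = 0" using z by (simp add: 0)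
    then show "c \<in> H1 G" using all c by (auto simp: H1_def simps)
  next
    fix c assume c: "c \<in> H1 G"
    then have "c z = 0" using z by (auto simp: H1_def)
    then show "c \<in> H1 (sprout x G)" using c unfolding H1_def mem_Collect_eq sum by (auto simp: simps 0)
  qed
qed

lemma valence_sprout:
  assumes "v \<in> insert z (verts G)"
  shows "valence (sprout x G) v = (if v = z then 1 else valence G v + of_bool (v = x))"
proof -
  have fin': "finite (edges (sprout x G))" using fin by (simp add: simps)
  have "(\<Sum>e\<in>edges G. incidence (sprout x G) v e) = (\<Sum>e\<in>edges G. incidence G v e)"
    by (rule sum.cong) (use z in \<open>auto simp: incidence_def simps is_loop_def\<close>)
  moreover have "incidence (sprout x G) v z = of_bool (v = x) + of_bool (v = z)"
    by (rule incidence_ends) (simp add: simps)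
  moreover have "(\<Sum>e\<in>edges G. incidence G z e) = 0"
    by (rule sum.neutral) (use z_ends in \<open>auto simp: incidence_def\<close>)
  ultimately show ?thesis
    unfolding valence_eq_sum_incidence[OF fin'] valence_eq_sum_incidence[OF fin(2)]
    using fin z by (auto simp: simps)
qed

lemma special_sprout:
  assumes "v \<in> verts G"
  shows "special n (sprout x G) v = special n G v + of_bool (v = x)"
  using assms valence_sprout[of v] z by (auto simp: special_def simps)

lemma connected_sprout:
  assumes "is_connected G" shows "is_connected (sprout x G)"
proof -
  have "adjacency G \<subseteq> adjacency (sprout x G)" using z unfolding adjacency_def by (fastforce simp: simps)
  then have *: "(u, v) \<in> (adjacency (sprout x G))\<^sup>*" if "u \<in> verts G" "v \<in> verts G" for u v
    using assms that rtrancl_mono unfolding is_connected_def by blast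
  have "(x, z) \<in> adjacency (sprout x G)" "(z, x) \<in> adjacency (sprout x G)"
    by (auto simp: adjacency_def simps)
  then have "(u, z) \<in> (adjacency (sprout x G))\<^sup>*" "(z, u) \<in> (adjacency (sprout x G))\<^sup>*" if "u \<in> verts G" for u
    using *[OF that x] *[OF x that] by (auto intro: rtrancl_into_rtrancl converse_rtrancl_into_rtrancl)
  then show ?thesis using * by (auto simp: is_connected_def simps)
qed

text \<open>
  The base vertex gains one half-edge and loses one unit of degree. Its stability is at stake only
  if no degree remains.
\<close>

lemma sprout_stable:
  assumes G: "G \<in> stable_graphs g n d" and sp: "deg G x = 1 \<Longrightarrow> 2 \<le> special n G x"
  shows "sprout x G \<in> stable_graphs g n d"
proof -
  note D = stable_graphsD[OF G]
  have "(\<Sum>v\<in>verts (sprout x G). genus (sprout x G) v) = (\<Sum>v\<in>verts G. genus G v)"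
    using fin z by (auto simp: simps intro!: sum.cong)
  moreover have "(\<Sum>v\<in>verts (sprout x G). deg (sprout x G) v) = (\<Sum>v\<in>verts G. deg G v)"
  proof -
    have "(\<Sum>v\<in>verts G. deg (sprout x G) v) + 1 = (\<Sum>v\<in>verts G. deg G v)"
      using z deg_pos by (simp add: sum.remove[OF fin(1) x] simps)
        (rule sum.cong; use z in auto)
    then show ?thesis using fin z by (simp add: simps)
  qed
  moreover have "3 \<le> special n (sprout x G) v" if "v \<in> verts (sprout x G)" "deg (sprout x G) v = 0" for v
    using that special_sprout[of v n] sp deg_pos D(10)[of v] by (auto simp: simps split: if_splits)
  moreover have "mark (sprout x G) ` {1..n} \<subseteq> verts (sprout x G)"
    using D(6) unfolding simps(1,6) by blast
  ultimately show ?thesis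
    using D(7,8) connected_sprout[OF D(2)] multigraph_sprout
    by (simp add: stable_graphs_def gnd_graph_def stable_iff_special H1_sprout dim_H1_eq)
qed

lemma unit_leaf_sprout:
  assumes G: "G \<in> stable_graphs g n d" and e: "edges G \<noteq> {}" and x_not: "\<not> unit_leaf n G x"
  shows "unit_leaf n (sprout x G) v \<longleftrightarrow> unit_leaf n G v \<or> v = z"
proof -
  note D = stable_graphsD[OF G]
  have "1 \<le> valence G x" using connected_valence_pos[OF D(1,2) e x] .
  moreover have "mark G i \<noteq> z" if "i \<in> {1..n}" for i using D(6) that z(1) by blast
  ultimately show ?thesis
    using valence_sprout[of v] x_not z by (cases "v \<in> insert z (verts G)") (auto simp: unit_leaf_def simps)
qed

lemma sprout_morphism:
  assumes G: "G \<in> stable_graphs g n d" and S: "sprout x G \<in> stable_graphs g n d"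
  shows "morphism g n d (sprout x G) (\<lambda>e. if e = z then None else Some e) G"
proof -
  note D = stable_graphsD[OF G]
  interpret nonloop "sprout x G" z x z by (rule nonloop_sprout)
  have C: "contract z (sprout x G) \<in> stable_graphs g n d"
    using contract_stable[OF S] by (simp add: simps)
  have zE: "z \<in> edges (sprout x G)" by (simp add: simps)
  have m: "collapse x z y = y" if "y \<in> verts G" for y using that z by (auto simp: collapse_def)
  have mi: "collapse x z ` A = A" if "A \<subseteq> verts G" for A
    using that m by (metis (no_types, lifting) image_cong image_ident subsetD)
  have "graph_iso n (contract z (sprout x G)) G id id"
    unfolding graph_iso_def
  proof (intro conjI ballI)
    fix e assume "e \<in> edges (contract z (sprout x G))"
    then have "e \<in> edges G" "e \<noteq> z" by (auto simp: simps contract_simps)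
    then show "ends G (id e) = id ` ends (contract z (sprout x G)) e"
      using D(11)[of e] by (simp add: contract_simps simps mi)
  next
    fix i assume "i \<in> {1..n}"
    then have "mark G i \<in> verts G" using D(6) by blast
    then show "mark G i = id (mark (contract z (sprout x G)) i)" by (simp add: contract_simps simps m)
  qed (use z deg_pos in \<open>auto simp: contract_simps simps\<close>)
  then have "morphism g n d (contract z (sprout x G)) (\<lambda>e. Some (id e)) G"
    using morphism.iso[OF C G] by blast
  then have "morphism g n d (sprout x G) (\<lambda>e. Option.bind (if e = z then None else Some e) (\<lambda>e. Some (id e))) G"
    by (rule morphism.comp[OF morphism.contraction[OF S C zE]])
  moreover have "(\<lambda>e. Option.bind (if e = z then None else Some e) (\<lambda>e. Some (id e))) = (\<lambda>e. if e = z then None else Some e)"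
    by auto
  ultimately show ?thesis by simp
qed

end

section \<open>Sproutings\<close>

text \<open>
  \<open>K\<close> arises from \<open>G\<close> by attaching leaves of genus 0 and degree 1: \<open>a\<close> and \<open>j\<close> embed the vertices and
  edges of \<open>G\<close>, and a new edge \<open>e\<close> joins the old vertex \<open>a (base e)\<close> to the new vertex \<open>tip e\<close>. Each new leaf
  takes one unit of degree from its base. The embeddings are needed because \<open>K\<close> has to serve as a
  sprouting of several graphs, with different labels.
\<close>

definition sprouting ::
    "nat \<Rightarrow> wgraph \<Rightarrow> wgraph \<Rightarrow> (nat \<Rightarrow> nat) \<Rightarrow> (nat \<Rightarrow> nat) \<Rightarrow> (nat \<Rightarrow> nat) \<Rightarrow> (nat \<Rightarrow> nat) \<Rightarrow> bool" where
  "sprouting n K G a j base tip \<longleftrightarrow>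
     inj_on a (verts G) \<and> a ` verts G \<subseteq> verts K \<and> inj_on j (edges G) \<and> j ` edges G \<subseteq> edges K \<and>
     (\<forall>e\<in>edges G. ends K (j e) = a ` ends G e) \<and>
     (\<forall>v\<in>verts G. genus K (a v) = genus G v) \<and>
     (\<forall>i\<in>{1..n}. mark K i = a (mark G i)) \<and>
     bij_betw tip (edges K - j ` edges G) (verts K - a ` verts G) \<and>
     (\<forall>e\<in>edges K - j ` edges G. base e \<in> verts G \<and> ends K e = {a (base e), tip e}) \<and>
     (\<forall>v\<in>verts G. deg G v = deg K (a v) + card {e \<in> edges K - j ` edges G. base e = v}) \<and>
     (\<forall>y\<in>verts K - a ` verts G. genus K y = 0 \<and> deg K y = 1)"

lemma sproutingD:
  assumes "sprouting n K G a j base tip"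
  shows "inj_on a (verts G)" "a ` verts G \<subseteq> verts K" "inj_on j (edges G)" "j ` edges G \<subseteq> edges K"
    "\<And>e. e \<in> edges G \<Longrightarrow> ends K (j e) = a ` ends G e"
    "\<And>v. v \<in> verts G \<Longrightarrow> genus K (a v) = genus G v"
    "\<And>i. i \<in> {1..n} \<Longrightarrow> mark K i = a (mark G i)"
    "bij_betw tip (edges K - j ` edges G) (verts K - a ` verts G)"
    "\<And>e. e \<in> edges K - j ` edges G \<Longrightarrow> base e \<in> verts G"
    "\<And>e. e \<in> edges K - j ` edges G \<Longrightarrow> ends K e = {a (base e), tip e}"
    "\<And>v. v \<in> verts G \<Longrightarrow> deg G v = deg K (a v) + card {e \<in> edges K - j ` edges G. base e = v}"
    "\<And>y. y \<in> verts K - a ` verts G \<Longrightarrow> genus K y = 0"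
    "\<And>y. y \<in> verts K - a ` verts G \<Longrightarrow> deg K y = 1"
  using assms by (simp_all add: sprouting_def)

lemma bij_betw_image_image:
  assumes "inj_on j A" "inj_on j' A" "\<And>x. x \<in> A \<Longrightarrow> h (j x) = j' x"
  shows "bij_betw h (j ` A) (j' ` A)"
proof (rule bij_betw_imageI)
  show "inj_on h (j ` A)"
  proof (rule inj_onI)
    fix y1 y2 assume "y1 \<in> j ` A" "y2 \<in> j ` A" "h y1 = h y2"
    then show "y1 = y2" using assms(2,3) by (auto dest: inj_onD)
  qed
  show "h ` j ` A = j' ` A" unfolding image_image using assms(3) by (rule image_cong[OF refl])
qed

text \<open>
  A sprouting is determined by how much degree stays on the old vertices: this fixes the number of
  new leaves at each of them, and these can be matched arbitrarily.
\<close>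

lemma sprouting_unique:
  assumes S: "sprouting n K G a j base tip" and S': "sprouting n K' G a' j' base' tip'"
    and fin: "finite (edges K)" "finite (edges K')"
    and deg: "\<And>v. v \<in> verts G \<Longrightarrow> deg K (a v) = deg K' (a' v)"
    and sub: "\<And>e. e \<in> edges G \<Longrightarrow> ends G e \<subseteq> verts G" and marks: "mark G ` {1..n} \<subseteq> verts G"
  obtains f h where "graph_iso n K K' f h" "\<And>e. e \<in> edges G \<Longrightarrow> h (j e) = j' e"
proof -
  note D = sproutingD[OF S] and D' = sproutingD[OF S']
  define N where "N = edges K - j ` edges G"
  define N' where "N' = edges K' - j' ` edges G"
  have "\<exists>b. bij_betw b {e \<in> N. base e = v} {e \<in> N'. base' e = v}" if "v \<in> verts G" for v
    using D(11)[OF that] D'(11)[OF that] deg[OF that] fin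
    by (intro finite_same_card_bij) (auto simp: N_def N'_def)
  then obtain b where b: "\<And>v. v \<in> verts G \<Longrightarrow> bij_betw (b v) {e \<in> N. base e = v} {e \<in> N'. base' e = v}"
    by metis
  \<comment> \<open>old edges correspond through \<open>G\<close>, new ones through the bijections \<open>b v\<close>; tips follow their edges\<close>
  define h where "h e = (if e \<in> j ` edges G then j' (inv_into (edges G) j e) else b (base e) e)" for e
  define f where "f y = (if y \<in> a ` verts G then a' (inv_into (verts G) a y)
      else tip' (h (inv_into N tip y)))" for y
  have hj: "h (j e) = j' e" if "e \<in> edges G" for e using that D(3) by (simp add: h_def)
  have fa: "f (a v) = a' v" if "v \<in> verts G" for v using that D(1) by (simp add: f_def)
  have hN: "h e = b (base e) e" if "e \<in> N" for e using that by (auto simp: h_def N_def)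
  have hN': "h e \<in> N'" "base' (h e) = base e" if "e \<in> N" for e
    using bij_betw_apply[OF b[OF D(9)[of e]], of e] that by (auto simp: hN N_def)
  have f_tip: "f (tip e) = tip' (h e)" if "e \<in> N" for e
  proof -
    have "tip e \<notin> a ` verts G" using D(8) that by (auto simp: bij_betw_def N_def)
    moreover have "inv_into N tip (tip e) = e"
      using D(8) that by (auto simp: bij_betw_def N_def)
    ultimately show ?thesis by (simp add: f_def)
  qed
  have bhN: "bij_betw h N N'"
  proof (rule bij_betwI')
    fix e1 e2 assume e: "e1 \<in> N" "e2 \<in> N"
    show "h e1 = h e2 \<longleftrightarrow> e1 = e2"
    proof
      assume eq: "h e1 = h e2"
      then have "base e1 = base e2" using hN'(2) e by metis
      moreover have "inj_on (b (base e1)) {e \<in> N. base e = base e1}"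
        using bij_betw_imp_inj_on[OF b[OF D(9)]] e by (simp add: N_def)
      ultimately show "e1 = e2"
        using eq e by (simp add: hN inj_on_def)
    qed simp
  next
    fix e' assume e': "e' \<in> N'"
    then have v: "base' e' \<in> verts G" using D'(9) by (simp add: N'_def)
    have "e' \<in> b (base' e') ` {e \<in> N. base e = base' e'}"
      using bij_betw_imp_surj_on[OF b[OF v]] e' by blast
    then obtain e where "e' = b (base' e') e" "e \<in> {e \<in> N. base e = base' e'}" by (rule imageE)
    then show "\<exists>e\<in>N. e' = h e" using hN[of e] by auto
  qed (use hN' in auto)
  have bj: "bij_betw h (j ` edges G) (j' ` edges G)"
    using bij_betw_image_image[OF D(3) D'(3) hj] .
  have "bij_betw h (j ` edges G \<union> N) (j' ` edges G \<union> N')"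
    by (rule bij_betw_combine[OF bj bhN]) (auto simp: N'_def)
  moreover have "j ` edges G \<union> N = edges K" "j' ` edges G \<union> N' = edges K'"
    using D(4) D'(4) by (auto simp: N_def N'_def)
  ultimately have bh: "bij_betw h (edges K) (edges K')" by simp
  have ba: "bij_betw f (a ` verts G) (a' ` verts G)"
    using bij_betw_image_image[OF D(1) D'(1) fa] .
  have "bij_betw (tip' \<circ> h) N (verts K' - a' ` verts G)"
    using bij_betw_trans[OF bhN D'(8)[folded N'_def]] .
  moreover have "bij_betw tip N (verts K - a ` verts G)" using D(8) by (simp add: N_def)
  then have bt: "bij_betw (inv_into N tip) (verts K - a ` verts G) N" by (rule bij_betw_inv_into)
  ultimately have "bij_betw (tip' \<circ> h \<circ> inv_into N tip) (verts K - a ` verts G) (verts K' - a' ` verts G)"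
    using bij_betw_trans by blast
  then have bn: "bij_betw f (verts K - a ` verts G) (verts K' - a' ` verts G)"
    by (rule bij_betw_cong[THEN iffD1, rotated]) (auto simp: f_def)
  have "bij_betw f (a ` verts G \<union> (verts K - a ` verts G)) (a' ` verts G \<union> (verts K' - a' ` verts G))"
    by (rule bij_betw_combine[OF ba bn]) auto
  moreover have "a ` verts G \<union> (verts K - a ` verts G) = verts K" "a' ` verts G \<union> (verts K' - a' ` verts G) = verts K'"
    using D(2) D'(2) by auto
  ultimately have bf: "bij_betw f (verts K) (verts K')" by simp
  have "graph_iso n K K' f h"
    unfolding graph_iso_def
  proof (intro conjI ballI bf bh)
    fix e assume e: "e \<in> edges K"
    show "ends K' (h e) = f ` ends K e"
    proof (cases "e \<in> j ` edges G")
      case True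
      then obtain e0 where e0: "e0 \<in> edges G" "e = j e0" by blast
      have "f ` a ` ends G e0 = a' ` ends G e0"
        using sub[OF e0(1)] fa by (auto simp: image_image subset_iff image_iff)
      then show ?thesis using e0 D(5) D'(5) by (simp add: hj)
    next
      case False
      then have N: "e \<in> N" using e by (simp add: N_def)
      then have N': "h e \<in> edges K' - j' ` edges G" using hN'(1) by (simp add: N'_def)
      have "ends K' (h e) = {a' (base e), tip' (h e)}"
        using D'(10)[OF N'] hN'(2)[OF N] by simp
      moreover have "ends K e = {a (base e), tip e}" "base e \<in> verts G" using D(9,10) e False by auto
      ultimately show ?thesis using fa f_tip[OF N] by simp
    qed
  next
    fix y assume y: "y \<in> verts K"
    have "genus K' (f y) = genus K y \<and> deg K' (f y) = deg K y"
    proof (cases "y \<in> a ` verts G")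
      case True then show ?thesis using fa D(6) D'(6) deg by auto
    next
      case False
      then have y': "y \<in> verts K - a ` verts G" using y by simp
      then have "f y \<in> verts K' - a' ` verts G" using bn bij_betw_apply by fast
      then show ?thesis using y' D(12,13) D'(12,13) by metis
    qed
    then show "genus K' (f y) = genus K y" "deg K' (f y) = deg K y" by blast+
  next
    fix i assume i: "i \<in> {1..n}"
    then have "mark G i \<in> verts G" using marks by blast
    then show "mark K' i = f (mark K i)" using D(7)[OF i] D'(7)[OF i] fa by simp
  qed
  then show ?thesis using that hj by blast
qed

text \<open>
  In a full graph all degree sits on unit leaves, whose number is then \<open>d\<close>.
\<close>

definition full :: "nat \<Rightarrow> wgraph \<Rightarrow> bool" where
  "full n K \<longleftrightarrow> (\<forall>v\<in>verts K. 0 < deg K v \<longrightarrow> unit_leaf n K v)"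

text \<open>
  Unit leaves must not sprout: losing its degree, a unit leaf would become an unstable vertex of
  valence 2. All other vertices give away their whole degree.
\<close>

definition complete_sprouting ::
    "nat \<Rightarrow> nat \<Rightarrow> nat \<Rightarrow> wgraph \<Rightarrow> wgraph \<Rightarrow> (nat \<Rightarrow> nat) \<Rightarrow> (nat \<Rightarrow> nat) \<Rightarrow> bool" where
  "complete_sprouting g n d K G a j \<longleftrightarrow> K \<in> stable_graphs g n d \<and> full n K \<and>
     (\<forall>v\<in>verts G. deg K (a v) = of_bool (unit_leaf n G v)) \<and> (\<exists>base tip. sprouting n K G a j base tip)"

lemma complete_sprouting_refl:
  assumes G: "G \<in> stable_graphs g n d" and "full n G"
  shows "complete_sprouting g n d G G id id"
proof -
  have "deg G v = of_bool (unit_leaf n G v)" if "v \<in> verts G" for v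
  proof (cases "unit_leaf n G v")
    case True then show ?thesis by (simp add: unit_leaf_def)
  next
    case False then show ?thesis using assms(2) that by (auto simp: full_def)
  qed
  moreover have "sprouting n G G id id id id" by (simp add: sprouting_def bij_betw_def)
  ultimately show ?thesis using assms unfolding complete_sprouting_def by auto
qed

text \<open>
  Leaves are attached one at a time. A base \<open>x\<close> left without degree stays stable: the graph has an edge
  at \<open>x\<close>, so \<open>special n G x \<ge> 1\<close>, and equality would make \<open>x\<close> a unit leaf. The induction is on the degree
  still sitting elsewhere than on unit leaves.
\<close>

lemma complete_sprouting_exists:
  assumes "G \<in> stable_graphs g n d" "edges G \<noteq> {}"
  shows "\<exists>K \<phi>. complete_sprouting g n d K G id id \<and> morphism g n d K \<phi> G \<and>
     (\<forall>e\<in>edges K. \<phi> e = (if e \<in> edges G then Some e else None))"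
  using assms
proof (induction "\<Sum>v\<in>verts G. if unit_leaf n G v then 0 else deg G v" arbitrary: G rule: less_induct)
  case less
  note D = stable_graphsD[OF less.prems(1)]
  show ?case
  proof (cases "full n G")
    case True
    have "graph_iso n G G id id" by (auto simp: graph_iso_def)
    then have "morphism g n d G (\<lambda>e. Some (id e)) G" using less.prems morphism.iso by blast
    then show ?thesis using complete_sprouting_refl[OF less.prems(1) True] by fastforce
  next
    case False
    then obtain x where xv: "x \<in> verts G" "0 < deg G x" "\<not> unit_leaf n G x" by (auto simp: full_def)
    define z where "z = fresh G"
    interpret sprouted G x z using D(1) xv z_def by unfold_locales
    have "1 \<le> valence G x" using connected_valence_pos[OF D(1,2) less.prems(2) xv(1)] .
    then have "2 \<le> special n G x" if "deg G x = 1"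
    proof -
      have "special n G x \<noteq> 1" using unit_leaf_iff_special[OF \<open>1 \<le> valence G x\<close>, of n] xv that by simp
      moreover have "1 \<le> special n G x" using \<open>1 \<le> valence G x\<close> by (simp add: special_def)
      ultimately show ?thesis by linarith
    qed
    then have S: "sprout x G \<in> stable_graphs g n d" by (rule sprout_stable[OF less.prems(1)])
    note ul = unit_leaf_sprout[OF less.prems xv(3)]
    have "(\<Sum>v\<in>verts (sprout x G). if unit_leaf n (sprout x G) v then 0 else deg (sprout x G) v)
        = (\<Sum>v\<in>verts G. if unit_leaf n (sprout x G) v then 0 else deg (sprout x G) v)"
      using fin z by (simp add: simps ul)
    also have "\<dots> < (\<Sum>v\<in>verts G. if unit_leaf n G v then 0 else deg G v)"
    proof (rule sum_strict_mono_ex1[OF fin(1)])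
      show "\<forall>v\<in>verts G. (if unit_leaf n (sprout x G) v then 0 else deg (sprout x G) v)
          \<le> (if unit_leaf n G v then 0 else deg G v)"
        using z by (auto simp: simps ul)
      show "\<exists>v\<in>verts G. (if unit_leaf n (sprout x G) v then 0 else deg (sprout x G) v)
          < (if unit_leaf n G v then 0 else deg G v)"
        using xv z by (intro bexI[of _ x]) (auto simp: simps ul)
    qed
    finally obtain K \<phi> where K: "complete_sprouting g n d K (sprout x G) id id" and m: "morphism g n d K \<phi> (sprout x G)"
      and \<phi>: "\<forall>e\<in>edges K. \<phi> e = (if e \<in> edges (sprout x G) then Some e else None)"
      using less.hyps[OF _ S] by (auto simp: simps)
    obtain base tip where sp: "sprouting n K (sprout x G) id id base tip" and KS: "K \<in> stable_graphs g n d" "full n K"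
      and degK: "\<And>v. v \<in> insert z (verts G) \<Longrightarrow> deg K v = of_bool (unit_leaf n (sprout x G) v)"
      using K by (auto simp: complete_sprouting_def simps)
    note P = sproutingD[OF sp, unfolded simps id_apply image_id]
    have finK: "finite (edges K)" using stable_graphsD[OF KS(1)] by blast
    let ?N = "edges K - insert z (edges G)"
    \<comment> \<open>the leaf just attached already is a unit leaf, so nothing is attached to it later\<close>
    have base_z: "base e \<noteq> z" if "e \<in> ?N" for e
    proof
      assume "base e = z"
      moreover have "card {e \<in> ?N. base e = z} = 0"
        using P(11)[of z] degK[of z] by (simp add: ul)
      then have "{e \<in> ?N. base e = z} = {}" using finK by simp
      ultimately show False using that by blast
    qed
    have sp': "sprouting n K G id id (base(z := x)) (tip(z := z))"
      unfolding sprouting_def id_apply image_id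
    proof (intro conjI ballI)
      have E: "edges K - edges G = insert z ?N" "z \<notin> ?N" using P(4) z by auto
      have V: "verts K - verts G = insert z (verts K - insert z (verts G))" using P(2) z by auto
      show "bij_betw (tip(z := z)) (edges K - edges G) (verts K - verts G)"
      proof -
        have "bij_betw (tip(z := z)) ?N (verts K - insert z (verts G))"
          using P(8) by (rule bij_betw_cong[THEN iffD1, rotated]) auto
        then have "bij_betw (tip(z := z)) (?N \<union> {z}) ((verts K - insert z (verts G)) \<union> {z})"
          by (rule bij_betw_combine) (auto simp: bij_betw_def)
        then show ?thesis unfolding E(1) V by simp
      qed
      show "(base(z := x)) e \<in> verts G" "ends K e = {(base(z := x)) e, (tip(z := z)) e}" if "e \<in> edges K - edges G" for e
        using that P(5)[of z] P(9)[of e] P(10)[of e] base_z[of e] xv(1) by (cases "e = z"; auto)+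
      fix v assume v: "v \<in> verts G"
      have "{e \<in> edges K - edges G. (base(z := x)) e = v} = (if v = x then insert z else id) {e \<in> ?N. base e = v}"
        unfolding E(1) using z by auto
      then have "card {e \<in> edges K - edges G. (base(z := x)) e = v} = of_bool (v = x) + card {e \<in> ?N. base e = v}"
        using finK by auto
      then show "deg G v = deg K v + card {e \<in> edges K - edges G. (base(z := x)) e = v}"
        using P(11)[of v] v z xv(2) by (auto simp: split: if_splits)
    next
      fix e assume "e \<in> edges G" then show "ends K e = ends G e" using P(5)[of e] z by (auto simp: split: if_splits)
    next
      fix v assume "v \<in> verts G" then show "genus K v = genus G v" using P(6)[of v] z by (auto split: if_splits)
    next
      fix y assume "y \<in> verts K - verts G"
      then show "genus K y = 0" "deg K y = 1" using P(6)[of z] P(12,13)[of y] degK[of z] 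
        by (cases "y = z"; auto simp: ul)+
    qed (use P(2,4,7) in auto)
    have "complete_sprouting g n d K G id id"
      unfolding complete_sprouting_def using sp' KS degK z by (auto simp: ul)
    moreover have "morphism g n d K (\<lambda>e. Option.bind (\<phi> e) (\<lambda>e. if e = z then None else Some e)) G"
      by (rule morphism.comp[OF m sprout_morphism[OF less.prems(1) S]])
    moreover have "\<forall>e\<in>edges K. Option.bind (\<phi> e) (\<lambda>e. if e = z then None else Some e) = (if e \<in> edges G then Some e else None)"
      using \<phi> z by (auto simp: simps)
    ultimately show ?thesis by blast
  qed
qed

section \<open>Sproutings and contractions\<close>

text \<open>
  The vertex merged from the unit leaf \<open>y\<close> and its neighbour \<open>x\<close> has one unit of degree more than \<open>x\<close>. The
  extra leaf that it sprouts is \<open>y\<close> again, so \<open>K\<close> need not change; only the merged vertex has to be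
  sent to \<open>x\<close>, since its name may be that of \<open>y\<close>.
\<close>

lemma complete_sprouting_contract_leaf:
  assumes G: "G \<in> stable_graphs g n d" and e: "e \<in> edges G" "ends G e = {x, y}"
    and y: "unit_leaf n G y" and x: "\<not> unit_leaf n G x"
    and K: "complete_sprouting g n d K G id id"
  obtains a where "complete_sprouting g n d K (contract e G) a id"
proof -
  note D = stable_graphsD[OF G]
  have KS: "K \<in> stable_graphs g n d" "full n K" and degK: "\<And>v. v \<in> verts G \<Longrightarrow> deg K v = of_bool (unit_leaf n G v)"
    using K by (auto simp: complete_sprouting_def)
  have finK: "finite (edges K)" using stable_graphsD[OF KS(1)] by blast
  obtain base tip where sp: "sprouting n K G id id base tip"
    using K by (auto simp: complete_sprouting_def)
  note P = sproutingD[OF sp, unfolded id_apply image_id]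
  have xy: "x \<noteq> y" using x y by auto
  define u where "u = min x y"
  define v where "v = max x y"
  have uv_xy: "(u = x \<and> v = y) \<or> (u = y \<and> v = x)" by (auto simp: u_def v_def min_def max_def)
  have nl: "nonloop G e u v"
    unfolding nonloop_def using D(1) e xy uv_xy by (auto simp: u_def v_def insert_commute)
  interpret nonloop G e u v by (rule nl)
  have y_props: "genus G y = 0" "deg G y = 1" "\<And>i. i \<in> {1..n} \<Longrightarrow> mark G i \<noteq> y" "valence G y = 1"
    using y by (auto simp: unit_leaf_def)
  have xy_verts: "x \<in> verts G" "y \<in> verts G" using uv uv_xy by auto
  have y_edge: "y \<notin> ends G e'" if e': "e' \<in> edges G" "e' \<noteq> e" for e'
  proof -
    obtain e1 where "\<forall>e''\<in>edges G. y \<in> ends G e'' \<longrightarrow> e'' = e1"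
      using y_props(4) valence_one_iff[OF D(3)] by blast
    then show ?thesis using e e' by (metis insertI1 insertI2)
  qed
  define a where "a w = (if w = u then x else w)" for w
  have ar: "a (collapse u v w) = (if w = y then x else w)" for w
    using uv_xy xy by (auto simp: a_def collapse_def)
  have inj_a: "inj_on a (verts G - {v})" using uv_xy xy by (auto simp: inj_on_def a_def)
  have img_a: "a ` verts (contract e G) = verts G - {y}"
    unfolding verts_contract image_image ar using xy_verts xy by (auto simp: image_iff)
  let ?N = "edges K - edges G"
  have N: "edges K - edges (contract e G) = insert e ?N" "e \<notin> ?N"
    using P(4) e by (auto simp: contract_simps)
  have V: "verts K - (verts G - {y}) = insert y (verts K - verts G)" using P(2) xy_verts by auto
  have base_y: "base b \<noteq> y" if "b \<in> ?N" for b
  proof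
    assume b: "base b = y"
    have "card {e \<in> ?N. base e = y} = 0"
      using P(11)[of y] degK[of y] xy_verts y y_props by simp
    then have "{e \<in> ?N. base e = y} = {}" using finK by simp
    then show False using b that by blast
  qed
  have sp': "sprouting n K (contract e G) a id (\<lambda>b. if b = e then u else collapse u v (base b)) (tip(e := y))"
    unfolding sprouting_def id_apply image_id img_a N V
  proof (intro conjI ballI)
    fix e' assume "e' \<in> edges (contract e G)"
    then have e': "e' \<in> edges G" "e' \<noteq> e" by (auto simp: contract_simps)
    have "a ` ends (contract e G) e' = (\<lambda>w. if w = y then x else w) ` ends G e'"
      by (simp add: contract_simps image_image ar)
    also have "\<dots> = ends G e'" using y_edge[OF e'] by (auto simp: image_iff)
    finally show "ends K e' = a ` ends (contract e G) e'" using P(5)[OF e'(1)] by simp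
  next
    fix w assume "w \<in> verts (contract e G)"
    then have w: "w \<in> verts G" "w \<noteq> v" by (auto simp: contract_simps)
    show "genus K (a w) = genus (contract e G) w"
      using P(6)[OF w(1)] P(6)[OF xy_verts(1)] uv_xy y_props by (auto simp: a_def contract_simps)
    show "deg (contract e G) w = deg K (a w) + card {b \<in> insert e ?N. (if b = e then u else collapse u v (base b)) = w}"
    proof (cases "w = u")
      case True
      have "{b \<in> insert e ?N. (if b = e then u else collapse u v (base b)) = w} = insert e {b \<in> ?N. base b = x}"
        using True N(2) base_y uv_xy by (auto simp: collapse_def)
      then have "card {b \<in> insert e ?N. (if b = e then u else collapse u v (base b)) = w} = Suc (card {b \<in> ?N. base b = x})"
        using finK N(2) by simp
      then show ?thesis
        using True P(11)[OF xy_verts(1)] y_props uv_xy by (auto simp: contract_simps a_def)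
    next
      case False
      then have "{b \<in> insert e ?N. (if b = e then u else collapse u v (base b)) = w} = {b \<in> ?N. base b = w}"
        using N(2) w by (auto simp: collapse_def)
      then show ?thesis using False P(11)[OF w(1)] by (simp add: contract_simps a_def)
    qed
  next
    fix i assume i: "i \<in> {1..n}"
    then show "mark K i = a (mark (contract e G) i)"
      using P(7)[OF i] y_props(3)[OF i] by (simp add: contract_simps ar)
  next
    have "bij_betw (tip(e := y)) ?N (verts K - verts G)"
      using P(8) by (rule bij_betw_cong[THEN iffD1, rotated]) (use e in auto)
    then have "bij_betw (tip(e := y)) (?N \<union> {e}) ((verts K - verts G) \<union> {y})"
      by (rule bij_betw_combine) (use xy_verts in \<open>auto simp: bij_betw_def\<close>)
    then show "bij_betw (tip(e := y)) (insert e ?N) (insert y (verts K - verts G))" by simp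
  next
    fix b assume b: "b \<in> insert e ?N"
    show "(if b = e then u else collapse u v (base b)) \<in> verts (contract e G)"
      using b uv P(9)[of b] by (auto simp: contract_simps collapse_def)
    show "ends K b = {a (if b = e then u else collapse u v (base b)), (tip(e := y)) b}"
    proof (cases "b = e")
      case True then show ?thesis using P(5)[OF e(1)] e(2) by (simp add: a_def)
    next
      case False
      then have "b \<in> ?N" using b by simp
      then show ?thesis using P(10)[of b] base_y[of b] False by (simp add: ar)
    qed
  next
    fix w assume "w \<in> insert y (verts K - verts G)"
    then show "genus K w = 0" "deg K w = 1"
      using P(6)[OF xy_verts(2)] P(12,13)[of w] degK[OF xy_verts(2)] y y_props by auto
  qed (use P(2,4) inj_a in \<open>auto simp: contract_simps\<close>)
  have "deg K (a w) = of_bool (unit_leaf n (contract e G) w)" if "w \<in> verts (contract e G)" for w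
    using that degK[of w] degK[OF xy_verts(1)] x ends_e unit_leaf_contract[OF G e(1)]
    by (auto simp: a_def contract_simps)
  then have "complete_sprouting g n d K (contract e G) a id"
    unfolding complete_sprouting_def using KS sp' by blast
  then show ?thesis using that by blast
qed

lemma full_contract:
  assumes K: "K \<in> stable_graphs g n d" "full n K" and e: "e \<in> edges K" "\<And>y. y \<in> ends K e \<Longrightarrow> deg K y = 0"
  shows "full n (contract e K)"
  unfolding full_def
proof (intro ballI impI)
  fix y assume y: "y \<in> verts (contract e K)" "0 < deg (contract e K) y"
  have "y \<notin> ends K e \<and> y \<in> verts K \<and> 0 < deg K y"
  proof (cases "is_loop K e")
    case True then show ?thesis using y e(2)[of y] by (auto simp: contract_loop_simps)
  next
    case False
    obtain u v where "nonloop K e u v" using stable_graphsD(1)[OF K(1)] e(1) False by (rule nonloop_edgeI)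
    then interpret nonloop K e u v .
    show ?thesis using y e(2)[of u] e(2)[of v] ends_e by (auto simp: contract_simps split: if_splits)
  qed
  then show "unit_leaf n (contract e K) y"
    using K(2) unfolding unit_leaf_contract[OF K(1) e(1)] by (simp add: full_def)
qed

text \<open>
  The ends of \<open>e\<close> have given away their degree in \<open>K\<close>, and contracting \<open>e\<close> in \<open>K\<close> collects the leaves of
  both at the merged vertex, which has the sum of their degrees in the contracted \<open>G\<close>.
\<close>

lemma complete_sprouting_contract_inner:
  assumes G: "G \<in> stable_graphs g n d" and e: "e \<in> edges G" "\<And>y. y \<in> ends G e \<Longrightarrow> \<not> unit_leaf n G y"
    and K: "complete_sprouting g n d K G id id"
  shows "complete_sprouting g n d (contract e K) (contract e G) id id"
proof -
  note D = stable_graphsD[OF G]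
  have KS: "K \<in> stable_graphs g n d" "full n K" and degK: "\<And>v. v \<in> verts G \<Longrightarrow> deg K v = of_bool (unit_leaf n G v)"
    using K by (auto simp: complete_sprouting_def)
  note DK = stable_graphsD[OF KS(1)]
  obtain base tip where sp: "sprouting n K G id id base tip"
    using K by (auto simp: complete_sprouting_def)
  note P = sproutingD[OF sp, unfolded id_apply image_id]
  have eK: "e \<in> edges K" "ends K e = ends G e" using e P(4,5) by auto
  have deg0: "deg K y = 0" if "y \<in> ends K e" for y
    using that e(2)[of y] degK[of y] D(11)[OF e(1)] eK by auto
  note C = contract_stable[OF KS(1) eK(1)] full_contract[OF KS eK(1) deg0]
  have "deg (contract e K) w = of_bool (unit_leaf n (contract e G) w) \<and> w \<in> verts G" if w: "w \<in> verts (contract e G)" for w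
  proof (cases "is_loop G e")
    case True
    then have "is_loop K e" using eK by (simp add: is_loop_def)
    then show ?thesis
      using w True degK[of w] deg0[of w] eK unit_leaf_contract[OF G e(1), of w]
      by (auto simp: contract_loop_simps)
  next
    case False
    obtain u v where G': "nonloop G e u v" using D(1) e(1) False by (rule nonloop_edgeI)
    then have "nonloop K e u v" using DK(1) eK by (simp add: nonloop_def)
    then interpret G: nonloop G e u v + K: nonloop K e u v using G' by auto
    show ?thesis
      using w degK[of w] deg0[of u] deg0[of v] G.ends_e eK unit_leaf_contract[OF G e(1), of w]
      by (auto simp: G.contract_simps K.contract_simps)
  qed
  moreover have "\<exists>base tip. sprouting n (contract e K) (contract e G) id id base tip"
  proof (cases "is_loop G e")
    case True
    then have L: "is_loop K e" using eK by (simp add: is_loop_def)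
    note S = contract_loop_simps[OF True] contract_loop_simps[OF L]
    have N: "edges K - {e} - (edges G - {e}) = edges K - edges G" using e by auto
    have "sprouting n (contract e K) (contract e G) id id base tip"
      unfolding sprouting_def id_apply image_id S N
    proof (intro conjI ballI)
      fix y assume y: "y \<in> verts K - verts G"
      then show "(if y \<in> ends K e then genus K y + 1 else genus K y) = 0" "deg K y = 1"
        using P(12,13)[OF y] deg0[of y] by auto
    qed (use P eK in auto)
    then show ?thesis by blast
  next
    case False
    obtain u v where G': "nonloop G e u v" using D(1) e(1) False by (rule nonloop_edgeI)
    then have "nonloop K e u v" using DK(1) eK by (simp add: nonloop_def)
    then interpret G: nonloop G e u v + K: nonloop K e u v using G' by auto
    note S = G.contract_simps K.contract_simps
    have N: "edges K - {e} - (edges G - {e}) = edges K - edges G" using e by auto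
    have V: "verts K - {v} - (verts G - {v}) = verts K - verts G" using G.uv by auto
    have "sprouting n (contract e K) (contract e G) id id (\<lambda>b. collapse u v (base b)) tip"
      unfolding sprouting_def id_apply image_id S N V
    proof (intro conjI ballI)
      fix b assume b: "b \<in> edges K - edges G"
      show "collapse u v (base b) \<in> verts G - {v}"
        using P(9)[OF b] G.uv by (auto simp: collapse_def)
      have "tip b \<notin> verts G" using P(8) b by (auto simp: bij_betw_def)
      then have "collapse u v (tip b) = tip b" using G.uv by (auto simp: collapse_def)
      then show "collapse u v ` ends K b = {collapse u v (base b), tip b}"
        using P(10)[OF b] by simp
    next
      fix w assume w: "w \<in> verts G - {v}"
      show "(if w = u then genus K u + genus K v else genus K w) = (if w = u then genus G u + genus G v else genus G w)"
        using w P(6)[of w] P(6)[OF G.uv(1)] P(6)[OF G.uv(2)] by simp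
      have fin: "finite (edges K - edges G)" using DK(3) by simp
      show "(if w = u then deg G u + deg G v else deg G w) =
         (if w = u then deg K u + deg K v else deg K w) + card {b \<in> edges K - edges G. collapse u v (base b) = w}"
      proof (cases "w = u")
        case True
        have "{b \<in> edges K - edges G. collapse u v (base b) = u} =
            {b \<in> edges K - edges G. base b = u} \<union> {b \<in> edges K - edges G. base b = v}"
          using G.uv by (auto simp: collapse_def)
        also have "card \<dots> = card {b \<in> edges K - edges G. base b = u} + card {b \<in> edges K - edges G. base b = v}"
          by (rule card_Un_disjoint) (use DK(3) G.uv in auto)
        finally show ?thesis using True P(11)[OF G.uv(1)] P(11)[OF G.uv(2)] by simp
      next
        case False
        then have "{b \<in> edges K - edges G. collapse u v (base b) = w} = {b \<in> edges K - edges G. base b = w}"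
          using w by (auto simp: collapse_def)
        then show ?thesis using False w P(11)[of w] by simp
      qed
    next
      fix y assume y: "y \<in> verts K - verts G"
      then have "y \<noteq> u" using G.uv by auto
      then show "(if y = u then genus K u + genus K v else genus K y) = 0"
        "(if y = u then deg K u + deg K v else deg K y) = 1"
        using P(12,13)[OF y] by auto
    qed (use P in auto)
    then show ?thesis by blast
  qed
  ultimately show ?thesis using C by (auto simp: complete_sprouting_def)
qed

section \<open>Leaf weights\<close>

text \<open>
  In a full graph this is the number of unit leaves at the edge: 1 on the edges of the leaves, 0 on
  the others, and 2 on the single edge between two unit leaves.
\<close>

definition leaf_weight :: "wgraph \<Rightarrow> nat \<Rightarrow> nat" where
  "leaf_weight K e = (\<Sum>x\<in>ends K e. deg K x)"

lemma leaf_weight_contract: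
  assumes K: "is_multigraph K" and e: "e \<in> edges K" "\<And>y. y \<in> ends K e \<Longrightarrow> deg K y = 0"
    and e': "e' \<in> edges K"
  shows "leaf_weight (contract e K) e' = leaf_weight K e'"
proof (cases "is_loop K e")
  case True then show ?thesis by (simp add: leaf_weight_def contract_loop_simps)
next
  case False
  obtain u v where "nonloop K e u v" using K e(1) False by (rule nonloop_edgeI)
  then interpret nonloop K e u v .
  have deg0: "deg K u = 0" "deg K v = 0" using e(2) ends_e by auto
  have fin: "finite (ends K e')" 
    using K e' by (rule multigraph_edge_ends) auto
  have "(\<Sum>x\<in>collapse u v ` ends K e'. deg (contract e K) x) = (\<Sum>x\<in>collapse u v ` ends K e' - {u}. deg (contract e K) x)"
    by (rule sum.mono_neutral_right) (use fin deg0 in \<open>auto simp: contract_simps\<close>)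
  also have "collapse u v ` ends K e' - {u} = ends K e' - {u, v}" by (auto simp: collapse_def image_iff)
  also have "(\<Sum>x\<in>ends K e' - {u, v}. deg (contract e K) x) = (\<Sum>x\<in>ends K e' - {u, v}. deg K x)"
    by (rule sum.cong) (auto simp: contract_simps)
  also have "\<dots> = (\<Sum>x\<in>ends K e'. deg K x)"
    by (rule sum.mono_neutral_left) (use fin deg0 in auto)
  finally show ?thesis by (simp add: leaf_weight_def contract_simps)
qed

lemma leaf_weight_iso:
  assumes "graph_iso n K K' f h" "e \<in> edges K" "ends K e \<subseteq> verts K"
  shows "leaf_weight K' (h e) = leaf_weight K e"
proof -
  have f: "inj_on f (verts K)" "\<And>v. v \<in> verts K \<Longrightarrow> deg K' (f v) = deg K v" "ends K' (h e) = f ` ends K e"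
    using assms by (auto simp: graph_iso_def bij_betw_def)
  then have "leaf_weight K' (h e) = (\<Sum>x\<in>ends K e. deg K' (f x))"
    using inj_on_subset[OF f(1) assms(3)] by (simp add: leaf_weight_def sum.reindex)
  also have "\<dots> = leaf_weight K e"
    unfolding leaf_weight_def by (rule sum.cong) (use f assms(3) in auto)
  finally show ?thesis .
qed

lemma sum_leaf_weight:
  assumes K: "K \<in> stable_graphs g n d" "full n K"
  shows "(\<Sum>e\<in>edges K. leaf_weight K e) = d"
proof -
  note D = stable_graphsD[OF K(1)]
  have "(\<Sum>e\<in>edges K. leaf_weight K e) = (\<Sum>e\<in>edges K. \<Sum>x\<in>verts K. if x \<in> ends K e then deg K x else 0)"
  proof (rule sum.cong[OF refl])
    fix e assume "e \<in> edges K"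
    then have "ends K e = {x \<in> verts K. x \<in> ends K e}" using D(11) by auto
    then show "leaf_weight K e = (\<Sum>x\<in>verts K. if x \<in> ends K e then deg K x else 0)"
      unfolding leaf_weight_def using sum.inter_filter[OF D(4)] by metis
  qed
  also have "\<dots> = (\<Sum>x\<in>verts K. \<Sum>e\<in>edges K. if x \<in> ends K e then deg K x else 0)"
    by (rule sum.swap)
  also have "\<dots> = (\<Sum>x\<in>verts K. deg K x)"
  proof (rule sum.cong[OF refl])
    fix x assume x: "x \<in> verts K"
    show "(\<Sum>e\<in>edges K. if x \<in> ends K e then deg K x else 0) = deg K x"
    proof (cases "deg K x = 0")
      case False
      then have "valence K x = 1" using K(2) x by (auto simp: full_def unit_leaf_def)
      then obtain e where e: "e \<in> edges K" "x \<in> ends K e" "\<forall>e'\<in>edges K. x \<in> ends K e' \<longrightarrow> e' = e"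
        using valence_one_iff[OF D(3)] by blast
      then have iff: "x \<in> ends K e' \<longleftrightarrow> e' = e" if "e' \<in> edges K" for e' using that by blast
      have "(\<Sum>e'\<in>edges K. if x \<in> ends K e' then deg K x else 0) = (\<Sum>e'\<in>edges K. if e' = e then deg K x else 0)"
        by (rule sum.cong) (simp_all add: iff)
      then show ?thesis using e(1) D(3) by simp
    qed (simp cong: if_cong)
  qed
  finally show ?thesis using D(8) by simp
qed

section \<open>Stars\<close>

definition point_graph :: "nat \<Rightarrow> nat \<Rightarrow> wgraph" where
  "point_graph g d = \<lparr> verts = {0}, edges = {}, ends = (\<lambda>_. {}), genus = (\<lambda>_. g), deg = (\<lambda>_. d), mark = (\<lambda>_. 0) \<rparr>"

text \<open>
  A cycle vanishes on every edge with an end of valence 1, by the boundary condition there.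
\<close>

lemma dim_H1_zero:
  assumes K: "is_multigraph K" and e: "\<And>e. e \<in> edges K \<Longrightarrow> \<exists>w\<in>ends K e. valence K w = 1"
  shows "dim_H1 K = 0"
proof -
  have fin: "finite (edges K)" using K by (simp add: is_multigraph_def)
  have "c e = 0" if c: "c \<in> H1 K" for c e
  proof (cases "e \<in> edges K")
    case True
    then obtain w where w: "w \<in> ends K e" "valence K w = 1" using e by blast
    then obtain e1 where e1: "\<not> is_loop K e1" "\<forall>e'\<in>edges K. w \<in> ends K e' \<longrightarrow> e' = e1"
      using valence_one_iff[OF fin] by blast
    then have "e1 = e" using True w by blast
    obtain p q where pq: "p < q" "ends K e = {p, q}"
      using K True by (rule multigraph_edge_cases) (use e1 \<open>e1 = e\<close> in auto)
    have "w \<in> verts K" using K True w by (auto simp: is_multigraph_def)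
    then have "0 = (\<Sum>e'\<in>edges K. c e' * boundary_coeff K w e')" using c by (auto simp: H1_def)
    also have "\<dots> = (\<Sum>e'\<in>edges K. if e' = e then c e * boundary_coeff K w e else 0)"
      by (rule sum.cong) (use e1 \<open>e1 = e\<close> boundary_coeff_outside[OF K] in auto)
    also have "\<dots> = c e * boundary_coeff K w e" using True fin by simp
    finally show ?thesis using boundary_coeff_ends[OF pq(2), of w] pq w by auto
  qed (use c in \<open>auto simp: H1_def\<close>)
  then have "H1 K \<subseteq> {0}" by (auto simp: zero_fun_def fun_eq_iff)
  then have "H1 K \<subseteq> cycles.span {}" using cycles.span_zero[of "{}"] by blast
  then show ?thesis
    using cycles.basis_card_eq_dim[of "{}" "H1 K"] cycles.independent_empty by (simp add: dim_H1_eq)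
qed

lemma point_graph_stable:
  assumes "0 < d"
  shows "point_graph g d \<in> stable_graphs g n d"
proof -
  have "is_multigraph (point_graph g d)" by (simp add: is_multigraph_def point_graph_def)
  moreover have "dim_H1 (point_graph g d) = 0"
    by (rule dim_H1_zero) (auto simp: is_multigraph_def point_graph_def)
  ultimately show ?thesis using assms
    by (auto simp: stable_graphs_def gnd_graph_def is_connected_def stable_def)
      (auto simp: point_graph_def)
qed

text \<open>
  A leaf can be attached to the graph with a single vertex unless its degree is 1 and
  \<open>2 * g + n \<le> 1\<close>.
\<close>

lemma stable_graph_with_edge:
  assumes "0 < d" "\<not> (g = 0 \<and> n \<le> 1 \<and> d = 1)"
  obtains G where "G \<in> stable_graphs g n d" "edges G \<noteq> {}"
proof -
  have st: "point_graph g d \<in> stable_graphs g n d" by (rule point_graph_stable[OF assms(1)])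
  interpret sprouted "point_graph g d" 0 "fresh (point_graph g d)"
    using assms stable_graphsD(1)[OF st] by unfold_locales (auto simp: point_graph_def)
  have "{i \<in> {1..n}. mark (point_graph g d) i = 0} = {1..n}" by (auto simp: point_graph_def)
  then have "special n (point_graph g d) 0 = 2 * g + n"
    by (simp add: special_def point_graph_def valence_def)
  then have "sprout 0 (point_graph g d) \<in> stable_graphs g n d"
    using assms by (intro sprout_stable[OF st]) (auto simp: point_graph_def)
  then show ?thesis using that simps(2) by blast
qed

text \<open>
  A full graph whose edges all carry positive weight is a star, and thus a sprouting of the graph
  with a single vertex. Its centre \<open>c\<close> is the vertex of degree 0. If there is none, all vertices are
  unit leaves, the graph is a single edge, and either end serves as \<open>c\<close>. The two cases exclude each
  other: for \<open>g = n = 0\<close> and \<open>d = 2\<close> a centre of degree 0 would have genus 0, valence 2 and no marking.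
\<close>

lemma star_sprouting:
  assumes S: "S \<in> stable_graphs g n d" "full n S" and edges: "\<And>e. e \<in> edges S \<Longrightarrow> \<exists>x\<in>ends S e. deg S x \<noteq> 0"
  obtains c tip where "sprouting n S (point_graph g d) (\<lambda>_. c) id (\<lambda>_. 0) tip"
    "deg S c = of_bool (g = 0 \<and> n = 0 \<and> d = 2)"
proof -
  note D = stable_graphsD[OF S(1)]
  have leaf: "unit_leaf n S w" if "w \<in> verts S" "deg S w \<noteq> 0" for w using S(2) that by (simp add: full_def)
  obtain c where c: "c \<in> verts S" "deg S c = 0 \<or> (\<forall>w\<in>verts S. deg S w \<noteq> 0)"
  proof (cases "\<exists>w\<in>verts S. deg S w = 0")
    case True then show ?thesis using that by blast
  next
    case False
    then have all: "\<forall>w\<in>verts S. deg S w \<noteq> 0" by simp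
    obtain w where "w \<in> verts S" using D(5) by blast
    then show ?thesis by (rule that) (use all in simp)
  qed
  \<comment> \<open>from \<open>c\<close> one reaches unit leaves only, and from these only \<open>c\<close>; so connectivity leaves no room for more\<close>
  have c_edge: "\<exists>w. w \<noteq> c \<and> ends S e = {c, w} \<and> unit_leaf n S w" if e: "e \<in> edges S" "c \<in> ends S e" for e
  proof -
    obtain w where w: "ends S e = {c, w}" 
      using D(1) e(1) by (rule multigraph_edge_ends) (use e(2) in auto)
    have wv: "w \<in> verts S" using D(11)[OF e(1)] w by auto
    show ?thesis
    proof (cases "deg S c = 0")
      case True
      then have "deg S w \<noteq> 0" using edges[OF e(1)] w by auto
      then show ?thesis using True leaf[OF wv] w by (intro exI[of _ w]) auto
    next
      case False
      then have all: "\<forall>w\<in>verts S. deg S w \<noteq> 0" using c(2) by (elim disjE) auto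
      then have "valence S c = 1" using leaf[OF c(1)] c by (auto simp: unit_leaf_def)
      then have "\<not> is_loop S e" using valence_one_iff[OF D(3)] e by blast
      then have "w \<noteq> c" using w by (auto simp: is_loop_def)
      then show ?thesis using w leaf[OF wv] all wv by blast
    qed
  qed
  have leaf_edge: "e' = e" if "unit_leaf n S w" "e \<in> edges S" "e' \<in> edges S" "w \<in> ends S e" "w \<in> ends S e'" for e e' w
    using that valence_one_iff[OF D(3), of w] unfolding unit_leaf_def by metis
  have reach: "w = c \<or> (w \<noteq> c \<and> unit_leaf n S w \<and> (\<exists>e\<in>edges S. ends S e = {c, w}))" if "(c, w) \<in> (adjacency S)\<^sup>*" for w
    using that
  proof induction
    case (step y z)
    then obtain e where e: "e \<in> edges S" "ends S e = {y, z}" by (auto simp: adjacency_def)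
    show ?case
    proof (cases "y = c")
      case True
      then obtain w where w: "w \<noteq> c" "ends S e = {c, w}" "unit_leaf n S w" using c_edge[of e] e by auto
      then have "w = z" using e True by (auto simp: doubleton_eq_iff)
      then show ?thesis using w e(1) by blast
    next
      case False
      then obtain e1 where e1: "unit_leaf n S y" "e1 \<in> edges S" "ends S e1 = {c, y}" using step.IH by blast
      then have "e = e1" using leaf_edge[of y e1 e] e by auto
      then have "z = c" using e e1 False by (auto simp: doubleton_eq_iff)
      then show ?thesis by simp
    qed
  qed simp
  have others: "unit_leaf n S w \<and> (\<exists>e\<in>edges S. ends S e = {c, w})" if "w \<in> verts S" "w \<noteq> c" for w
    using reach[of w] that c(1) D(2) by (auto simp: is_connected_def)
  have all_edges: "\<exists>w. w \<noteq> c \<and> ends S e = {c, w} \<and> unit_leaf n S w" if e: "e \<in> edges S" for e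
  proof (cases "c \<in> ends S e")
    case False
    obtain w where w: "w \<in> ends S e" "w \<in> verts S" using edges[OF e] D(11)[OF e] by blast
    then obtain e1 where "unit_leaf n S w" "e1 \<in> edges S" "ends S e1 = {c, w}" using others[of w] False by auto
    then have "e = e1" using leaf_edge[of w e1 e] e w by auto
    then show ?thesis using False \<open>ends S e1 = {c, w}\<close> by auto
  qed (use c_edge e in blast)
  then obtain tip where tip: "\<And>e. e \<in> edges S \<Longrightarrow> tip e \<noteq> c" "\<And>e. e \<in> edges S \<Longrightarrow> ends S e = {c, tip e}"
     "\<And>e. e \<in> edges S \<Longrightarrow> unit_leaf n S (tip e)" by metis
  have bij: "bij_betw tip (edges S) (verts S - {c})"
  proof (rule bij_betw_imageI)
    show "inj_on tip (edges S)"
      using leaf_edge tip by (intro inj_onI) (metis insertI1 insertI2)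
    show "tip ` edges S = verts S - {c}"
    proof (intro equalityI subsetI)
      fix w assume w: "w \<in> verts S - {c}"
      then obtain e where "e \<in> edges S" "ends S e = {c, w}" using others by blast
      moreover from this have "tip e = w" using tip(2)[of e] w by (auto simp: doubleton_eq_iff)
      ultimately show "w \<in> tip ` edges S" by blast
    qed (use tip(1,3) in \<open>auto simp: unit_leaf_def\<close>)
  qed
  have others': "genus S w = 0" "deg S w = 1" if "w \<in> verts S - {c}" for w
    using others[of w] that by (auto simp: unit_leaf_def)
  have "dim_H1 S = 0"
    by (rule dim_H1_zero[OF D(1)]) (use tip(2,3) in \<open>auto simp: unit_leaf_def\<close>)
  moreover have "(\<Sum>v\<in>verts S. genus S v) = genus S c"
    using others' by (simp add: sum.remove[OF D(4) c(1)])
  ultimately have gc: "genus S c = g" using D(7) by simp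
  have "(\<Sum>v\<in>verts S. deg S v) = deg S c + card (verts S - {c})"
    using others' by (simp add: sum.remove[OF D(4) c(1)])
  also have "card (verts S - {c}) = card (edges S)" using bij_betw_same_card[OF bij] by simp
  finally have dc: "d = deg S c + card (edges S)" using D(8) by simp
  have mc: "mark S i = c" if i: "i \<in> {1..n}" for i
  proof (rule ccontr)
    assume "mark S i \<noteq> c"
    moreover have "mark S i \<in> verts S" using D(6) i by blast
    ultimately have "unit_leaf n S (mark S i)" using others by blast
    then show False using i unfolding unit_leaf_def by blast
  qed
  have vc: "valence S c = card (edges S)"
  proof -
    have "valence S c = (\<Sum>e\<in>edges S. 1)"
      unfolding valence_eq_sum_incidence[OF D(3)]
      by (rule sum.cong) (use tip in \<open>auto simp: incidence_ends\<close>)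
    then show ?thesis by simp
  qed
  have "sprouting n S (point_graph g d) (\<lambda>_. c) id (\<lambda>_. 0) tip"
    using c bij tip gc dc mc others' by (simp add: sprouting_def point_graph_def)
  moreover have "deg S c = of_bool (g = 0 \<and> n = 0 \<and> d = 2)"
  proof (cases "deg S c = 0")
    case True
    then have "3 \<le> special n S c" using D(10) c by blast
    then have "\<not> (n = 0 \<and> g = 0 \<and> d = 2)" using True dc gc vc by (intro notI) (simp add: special_def)
    then show ?thesis using True by auto
  next
    case False
    then have l: "unit_leaf n S c" using leaf c by blast
    then have "card (edges S) = 1" "deg S c = 1" "genus S c = 0" using vc by (auto simp: unit_leaf_def)
    moreover have "n = 0"
    proof (rule ccontr)
      assume "n \<noteq> 0"
      then have "1 \<in> {1..n}" by simp
      then show False using mc l unfolding unit_leaf_def by blast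
    qed
    ultimately show ?thesis using gc dc by simp
  qed
  ultimately show ?thesis using that by blast
qed

section \<open>Points of the virtual dual complex\<close>

lemma mem_kappa:
  "l \<in> topspace (kappa G) \<longleftrightarrow>
     l \<in> extensional (edges G) \<and> (\<forall>e\<in>edges G. 0 \<le> l e) \<and> (\<Sum>e\<in>edges G. l e) = 1"
  by (auto simp: kappa_def PiE_UNIV_domain extensional_def PiE_def)

lemma kappa_edges: "l \<in> topspace (kappa G) \<Longrightarrow> edges G \<noteq> {}"
  by (auto simp: mem_kappa)

lemma morphism_stable:
  "morphism g n d G \<phi> G' \<Longrightarrow> G \<in> stable_graphs g n d \<and> G' \<in> stable_graphs g n d"
  by (induction rule: morphism.induct) auto

lemma edges_contract: "edges (contract e G) = edges G - {e}"
  by (simp add: contract_def contract_loop_def contract_nonloop_def Let_def)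

lemma morphism_edges:
  "morphism g n d G \<phi> G' \<Longrightarrow> e \<in> edges G \<Longrightarrow> \<phi> e = Some e' \<Longrightarrow> e' \<in> edges G'"
proof (induction arbitrary: e e' rule: morphism.induct)
  case (iso G G' f h)
  then show ?case by (auto simp: graph_iso_def bij_betw_def)
next
  case (contraction G e0)
  then have "e \<noteq> e0" "e' = e" by (auto split: if_splits)
  then show ?case using contraction by (simp add: edges_contract)
next
  case (comp G \<phi> G' \<psi> G'')
  then show ?case by (auto simp: bind_eq_Some_conv)
qed

lemma extend_metric_comp:
  assumes "morphism g n d G \<phi> G'"
  shows "extend_metric G (\<lambda>e. Option.bind (\<phi> e) \<psi>) l = extend_metric G \<phi> (extend_metric G' \<psi> l)"
  using morphism_edges[OF assms] 
  by (auto simp: extend_metric_def fun_eq_iff restrict_def split: option.splits)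

lemma extend_metric_kappa:
  "morphism g n d G \<phi> G' \<Longrightarrow> l \<in> topspace (kappa G') \<Longrightarrow> extend_metric G \<phi> l \<in> topspace (kappa G)"
proof (induction arbitrary: l rule: morphism.induct)
  case (iso G G' f h)
  then have h: "bij_betw h (edges G) (edges G')" by (simp add: graph_iso_def)
  have "(\<Sum>e\<in>edges G. l (h e)) = 1"
    using iso.prems by (simp add: sum.reindex_bij_betw[OF h] mem_kappa)
  then show ?case using iso.prems bij_betw_apply[OF h] by (auto simp: mem_kappa extend_metric_def extensional_def)
next
  case (contraction G e)
  have "finite (edges G)" using contraction stable_graphsD by blast
  then show ?case using contraction
    by (auto simp: mem_kappa extend_metric_def edges_contract extensional_def sum.remove[of "edges G" e])
next
  case (comp G \<phi> G' \<psi> G'')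
  then show ?case by (simp add: extend_metric_comp[OF comp.hyps(1)])
qed

definition arrows :: "nat \<Rightarrow> nat \<Rightarrow> nat \<Rightarrow> (wgraph \<times> wgraph \<times> ((nat \<Rightarrow> real) \<Rightarrow> nat \<Rightarrow> real)) set" where
  "arrows g n d = {(G', G, extend_metric G \<phi>) | G \<phi> G'. morphism g n d G \<phi> G'}"

definition point_of :: "nat \<Rightarrow> nat \<Rightarrow> nat \<Rightarrow> wgraph \<Rightarrow> (nat \<Rightarrow> real) \<Rightarrow> (wgraph \<times> (nat \<Rightarrow> real)) set" where
  "point_of g n d G l = colimit_rel kappa (stable_graphs g n d) (arrows g n d) `` {(G, l)}"

lemma virtual_dual_complex_eq:
  "virtual_dual_complex g n d = colimit kappa (stable_graphs g n d) (arrows g n d)"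
  by (simp add: virtual_dual_complex_def arrows_def)

text \<open>
  The identifications that define the colimit.
\<close>

lemma point_of_morphism:
  assumes "morphism g n d G \<phi> G'" "l \<in> topspace (kappa G')"
  shows "point_of g n d G' l = point_of g n d G (extend_metric G \<phi> l)"
  unfolding point_of_def
proof (rule equiv_class_eq[OF equiv_colimit_rel])
  have "(G', G, extend_metric G \<phi>) \<in> arrows g n d" using assms(1) by (auto simp: arrows_def)
  then have "\<exists>(i, j, f)\<in>arrows g n d. \<exists>x\<in>topspace (kappa i). (G', l) = (i, x) \<and> (G, extend_metric G \<phi> l) = (j, f x)"
    using assms(2) by blast
  then have "equivclp (\<lambda>p q. \<exists>(i, j, f)\<in>arrows g n d. \<exists>x\<in>topspace (kappa i). p = (i, x) \<and> q = (j, f x))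
      (G', l) (G, extend_metric G \<phi> l)"
    by (rule r_into_equivclp)
  then show "((G', l), (G, extend_metric G \<phi> l)) \<in> colimit_rel kappa (stable_graphs g n d) (arrows g n d)"
    using morphism_stable[OF assms(1)] extend_metric_kappa[OF assms] assms(2)
    unfolding colimit_rel_def by simp
qed

section \<open>The flow towards the leaves\<close>

text \<open>
  The straight line in the simplex of \<open>K\<close> from the metric \<open>l\<close> of \<open>G\<close>, carried over by \<open>j\<close> and extended by 0
  to the new edges, to \<open>leaf_metric\<close>.
\<close>

definition flow :: "nat \<Rightarrow> wgraph \<Rightarrow> wgraph \<Rightarrow> (nat \<Rightarrow> nat) \<Rightarrow> (nat \<Rightarrow> real) \<Rightarrow> real \<Rightarrow> nat \<Rightarrow> real" where
  "flow d K G j l t = (\<lambda>e\<in>edges K.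
     (1 - t) * (if e \<in> j ` edges G then l (inv_into (edges G) j e) else 0) + t * (leaf_weight K e / d))"

definition leaf_metric :: "nat \<Rightarrow> wgraph \<Rightarrow> nat \<Rightarrow> real" where
  "leaf_metric d K = (\<lambda>e\<in>edges K. leaf_weight K e / d)"

lemma leaf_metric_kappa:
  assumes "K \<in> stable_graphs g n d" "full n K" "0 < d"
  shows "leaf_metric d K \<in> topspace (kappa K)"
proof -
  have "(\<Sum>e\<in>edges K. real (leaf_weight K e) / d) = 1"
    using sum_leaf_weight[OF assms(1,2)] assms(3) by (simp flip: sum_divide_distrib of_nat_sum)
  then show ?thesis by (simp add: mem_kappa leaf_metric_def)
qed

lemma flow_kappa:
  assumes K: "complete_sprouting g n d K G a j" and d: "0 < d"
    and l: "l \<in> topspace (kappa G)" and t: "t \<in> {0..1}"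
  shows "flow d K G j l t \<in> topspace (kappa K)"
proof -
  have KS: "K \<in> stable_graphs g n d" "full n K" using K by (auto simp: complete_sprouting_def)
  have fin: "finite (edges K)" using stable_graphsD[OF KS(1)] by blast
  obtain base tip where "sprouting n K G a j base tip" using K by (auto simp: complete_sprouting_def)
  note j = sproutingD(3,4)[OF this]
  have "(\<Sum>e\<in>edges K. if e \<in> j ` edges G then l (inv_into (edges G) j e) else 0)
      = (\<Sum>e\<in>j ` edges G. l (inv_into (edges G) j e))"
    using j fin by (simp add: sum.inter_restrict[symmetric] Int_absorb1 cong: if_cong)
  also have "\<dots> = (\<Sum>e\<in>edges G. l e)" using j by (simp add: sum.reindex)
  finally have 1: "(\<Sum>e\<in>edges K. if e \<in> j ` edges G then l (inv_into (edges G) j e) else 0) = 1"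
    using l by (simp add: mem_kappa)
  have 2: "(\<Sum>e\<in>edges K. real (leaf_weight K e) / d) = 1"
    using sum_leaf_weight[OF KS] d by (simp flip: sum_divide_distrib of_nat_sum)
  have "(\<Sum>e\<in>edges K. flow d K G j l t e) =
     (1 - t) * (\<Sum>e\<in>edges K. if e \<in> j ` edges G then l (inv_into (edges G) j e) else 0)
       + t * (\<Sum>e\<in>edges K. real (leaf_weight K e) / d)"
    by (simp add: flow_def sum.distrib sum_distrib_left)
  then have "(\<Sum>e\<in>edges K. flow d K G j l t e) = 1" unfolding 1 2 by simp
  moreover have "0 \<le> flow d K G j l t e" if "e \<in> edges K" for e
    using that t l j by (auto simp: flow_def mem_kappa inv_into_into)
  ultimately show ?thesis by (simp add: mem_kappa flow_def)
qed

lemma point_of_iso: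
  assumes K: "K \<in> stable_graphs g n d" "K' \<in> stable_graphs g n d" and iso: "graph_iso n K K' f h"
    and m: "m' \<in> topspace (kappa K')" "m \<in> extensional (edges K)" "\<And>e. e \<in> edges K \<Longrightarrow> m e = m' (h e)"
  shows "point_of g n d K m = point_of g n d K' m'"
proof -
  have "extend_metric K (\<lambda>e. Some (h e)) m' = m"
    using m(2,3) by (auto simp: extend_metric_def fun_eq_iff extensional_def)
  then show ?thesis using point_of_morphism[OF morphism.iso[OF K iso] m(1)] by simp
qed

text \<open>
  The isomorphism between the two sproutings respects both ends of the lines.
\<close>

lemma point_of_flow_unique:
  assumes K: "complete_sprouting g n d K G a j" and K': "complete_sprouting g n d K' G a' j'" 
    and G: "G \<in> stable_graphs g n d" and d: "0 < d"
    and l: "l \<in> topspace (kappa G)" and t: "t \<in> {0..1}"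
  shows "point_of g n d K (flow d K G j l t) = point_of g n d K' (flow d K' G j' l t)"
proof -
  note D = stable_graphsD[OF G]
  have KS: "K \<in> stable_graphs g n d" "K' \<in> stable_graphs g n d" using K K' by (auto simp: complete_sprouting_def)
  note DK = stable_graphsD[OF KS(1)] and DK' = stable_graphsD[OF KS(2)]
  obtain base tip where S: "sprouting n K G a j base tip" using K by (auto simp: complete_sprouting_def)
  obtain base' tip' where S': "sprouting n K' G a' j' base' tip'" using K' by (auto simp: complete_sprouting_def)
  obtain f h where iso: "graph_iso n K K' f h" and hj: "\<And>e. e \<in> edges G \<Longrightarrow> h (j e) = j' e"
    by (rule sprouting_unique[OF S S' DK(3) DK'(3) _ D(11,6)])
      (use K K' in \<open>auto simp: complete_sprouting_def\<close>)
  have h: "inj_on h (edges K)" "\<And>e. e \<in> edges K \<Longrightarrow> h e \<in> edges K'"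
    using iso by (auto simp: graph_iso_def bij_betw_def)
  note j = sproutingD(3,4)[OF S] and j' = sproutingD(3,4)[OF S']
  show ?thesis
  proof (rule point_of_iso[OF KS iso flow_kappa[OF K' d l t]])
    fix e assume e: "e \<in> edges K"
    have w: "leaf_weight K' (h e) = leaf_weight K e" by (rule leaf_weight_iso[OF iso e DK(11)[OF e]])
    show "flow d K G j l t e = flow d K' G j' l t (h e)"
    proof (cases "e \<in> j ` edges G")
      case True
      then obtain e0 where "e0 \<in> edges G" "e = j e0" by blast
      then show ?thesis using e h(2)[OF e] j(1) j'(1) hj w by (simp add: flow_def)
    next
      case False
      have "h e \<notin> j' ` edges G"
      proof
        assume "h e \<in> j' ` edges G"
        then obtain e0 where e0: "e0 \<in> edges G" "h e = h (j e0)" using hj by auto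
        then have "e = j e0" using h(1) e j(2) by (auto dest: inj_onD)
        then show False using False e0 by blast
      qed
      then show ?thesis using False e h(2)[OF e] w by (simp add: flow_def)
    qed
  qed (simp add: flow_def)
qed

text \<open>
  The labels of \<open>G\<close> are kept, so that the same edge can be contracted in both graphs.
\<close>

definition hat :: "nat \<Rightarrow> nat \<Rightarrow> nat \<Rightarrow> wgraph \<Rightarrow> wgraph" where
  "hat g n d G = (SOME K. \<exists>\<phi>. complete_sprouting g n d K G id id \<and> morphism g n d K \<phi> G \<and>
     (\<forall>e\<in>edges K. \<phi> e = (if e \<in> edges G then Some e else None)))"

lemma hat:
  assumes "G \<in> stable_graphs g n d" "edges G \<noteq> {}"
  shows "complete_sprouting g n d (hat g n d G) G id id"
    "\<exists>\<phi>. morphism g n d (hat g n d G) \<phi> G \<and> (\<forall>e\<in>edges (hat g n d G). \<phi> e = (if e \<in> edges G then Some e else None))"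
  using someI_ex[OF complete_sprouting_exists[OF assms], folded hat_def] by blast+

definition slide :: "nat \<Rightarrow> nat \<Rightarrow> nat \<Rightarrow> wgraph \<Rightarrow> (nat \<Rightarrow> real) \<Rightarrow> real \<Rightarrow> (wgraph \<times> (nat \<Rightarrow> real)) set" where
  "slide g n d G l t = point_of g n d (hat g n d G) (flow d (hat g n d G) G id l t)"

lemma slide_eq:
  assumes K: "complete_sprouting g n d K G a j"
    and G: "G \<in> stable_graphs g n d" and d: "0 < d"
    and l: "l \<in> topspace (kappa G)" and t: "t \<in> {0..1}"
  shows "slide g n d G l t = point_of g n d K (flow d K G j l t)"
  unfolding slide_def
  by (rule point_of_flow_unique[OF hat(1)[OF G kappa_edges[OF l]] K G d l t])

lemma inv_into_id: "x \<in> A \<Longrightarrow> inv_into A id x = x"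
  by (metis id_apply inj_on_id inv_into_f_f)

lemma slide_0:
  assumes G: "G \<in> stable_graphs g n d" and l: "l \<in> topspace (kappa G)"
  shows "slide g n d G l 0 = point_of g n d G l"
proof -
  obtain \<phi> where \<phi>: "morphism g n d (hat g n d G) \<phi> G" "\<forall>e\<in>edges (hat g n d G). \<phi> e = (if e \<in> edges G then Some e else None)"
    using hat(2)[OF G kappa_edges[OF l]] by blast
  have "extend_metric (hat g n d G) \<phi> l = flow d (hat g n d G) G id l 0"
    using \<phi>(2) by (auto simp: extend_metric_def flow_def fun_eq_iff restrict_def inv_into_id)
  then show ?thesis using point_of_morphism[OF \<phi>(1) l] by (simp add: slide_def)
qed

lemma unit_leaf_iso:
  assumes iso: "graph_iso n G G' f h" and G: "G \<in> stable_graphs g n d" "finite (edges G')" and v: "v \<in> verts G"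
  shows "unit_leaf n G' (f v) \<longleftrightarrow> unit_leaf n G v"
proof -
  note D = stable_graphsD[OF G(1)]
  have f: "inj_on f (verts G)" "f v \<in> verts G'" and h: "bij_betw h (edges G) (edges G')"
    and ends: "\<And>e. e \<in> edges G \<Longrightarrow> ends G' (h e) = f ` ends G e" and m: "\<And>i. i \<in> {1..n} \<Longrightarrow> mark G' i = f (mark G i)"
    using iso v by (auto simp: graph_iso_def bij_betw_def)
  have inc: "incidence G' (f v) (h e) = incidence G v e" if e: "e \<in> edges G" for e
  proof -
    obtain p q where pq: "ends G e = {p, q}" using D(1) e by (rule multigraph_edge_ends)
    then have "p \<in> verts G" "q \<in> verts G" using D(11)[OF e] by auto
    then have "f v = f p \<longleftrightarrow> v = p" "f v = f q \<longleftrightarrow> v = q" using f(1) v by (auto dest: inj_onD)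
    moreover have "ends G' (h e) = {f p, f q}" using ends[OF e] pq by simp
    ultimately show ?thesis using pq by (simp add: incidence_ends)
  qed
  have "valence G' (f v) = (\<Sum>e\<in>edges G. incidence G' (f v) (h e))"
    by (simp add: valence_eq_sum_incidence[OF G(2)] sum.reindex_bij_betw[OF h])
  then have "valence G' (f v) = valence G v"
    by (simp add: inc valence_eq_sum_incidence[OF D(3)])
  moreover have "f (mark G i) = f v \<longleftrightarrow> mark G i = v" if "i \<in> {1..n}" for i
  proof -
    have "mark G i \<in> verts G" using D(6) that by blast
    then show ?thesis using f(1) v by (auto dest: inj_onD)
  qed
  moreover have "genus G' (f v) = genus G v" "deg G' (f v) = deg G v" using iso v by (auto simp: graph_iso_def)
  ultimately show ?thesis using f(2) v m by (simp add: unit_leaf_def)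
qed

lemma complete_sprouting_iso:
  assumes iso: "graph_iso n G G' f h" and G: "G \<in> stable_graphs g n d" "G' \<in> stable_graphs g n d"
    and K: "complete_sprouting g n d K G' a j"
  shows "complete_sprouting g n d K G (a \<circ> f) (j \<circ> h)"
proof -
  note D = stable_graphsD[OF G(1)] and D' = stable_graphsD[OF G(2)]
  obtain base tip where S: "sprouting n K G' a j base tip" using K by (auto simp: complete_sprouting_def)
  note P = sproutingD[OF S]
  have f: "inj_on f (verts G)" "f ` verts G = verts G'" and h: "inj_on h (edges G)" "h ` edges G = edges G'"
    and I: "\<And>e. e \<in> edges G \<Longrightarrow> ends G' (h e) = f ` ends G e" "\<And>i. i \<in> {1..n} \<Longrightarrow> mark G' i = f (mark G i)"
      "\<And>v. v \<in> verts G \<Longrightarrow> genus G' (f v) = genus G v" "\<And>v. v \<in> verts G \<Longrightarrow> deg G' (f v) = deg G v"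
    using iso by (auto simp: graph_iso_def bij_betw_def)
  define b where "b e = inv_into (verts G) f (base e)" for e
  have b: "b e \<in> verts G" "f (b e) = base e" if "e \<in> edges K - j ` edges G'" for e
    using P(9)[OF that] f by (auto simp: b_def inv_into_into f_inv_into_f)
  have img: "(a \<circ> f) ` verts G = a ` verts G'" "(j \<circ> h) ` edges G = j ` edges G'"
    unfolding image_comp[symmetric] f h by (rule refl)+
  have "sprouting n K G (a \<circ> f) (j \<circ> h) b tip"
    unfolding sprouting_def img
  proof (intro conjI ballI)
    show "inj_on (a \<circ> f) (verts G)" "inj_on (j \<circ> h) (edges G)"
      using P(1,3) f h by (auto intro: comp_inj_on)
    fix v assume v: "v \<in> verts G"
    have "{e \<in> edges K - j ` edges G'. base e = f v} = {e \<in> edges K - j ` edges G'. b e = v}"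
    proof (intro Collect_cong conj_cong refl)
      fix e assume "e \<in> edges K - j ` edges G'"
      then show "base e = f v \<longleftrightarrow> b e = v" using b[of e] v f(1) by (auto dest: inj_onD)
    qed
    then show "deg G v = deg K ((a \<circ> f) v) + card {e \<in> edges K - j ` edges G'. b e = v}"
      using P(11)[OF imageI[of v "verts G" f, unfolded f(2), OF v]] I(4)[OF v] by simp
  next
    fix v assume "v \<in> verts G" then show "genus K ((a \<circ> f) v) = genus G v" using P(6)[of "f v"] f I by auto
  next
    fix e assume e: "e \<in> edges G"
    then have "h e \<in> edges G'" using h by auto
    then show "ends K ((j \<circ> h) e) = (a \<circ> f) ` ends G e" using P(5) I(1)[OF e] by (simp add: image_comp)
  next
    fix i assume "i \<in> {1..n}" then show "mark K i = (a \<circ> f) (mark G i)" using P(7) I(2) by simp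
  next
    fix e assume e: "e \<in> edges K - j ` edges G'"
    show "b e \<in> verts G" "ends K e = {(a \<circ> f) (b e), tip e}" using b[OF e] P(10)[OF e] by simp_all
  next
    fix y assume "y \<in> verts K - a ` verts G'"
    then show "genus K y = 0" "deg K y = 1" using P(12,13) by blast+
  qed (use P(2,4,8) in blast)+
  moreover have "deg K ((a \<circ> f) v) = of_bool (unit_leaf n G v)" if "v \<in> verts G" for v
    using K that unit_leaf_iso[OF iso G(1) D'(3) that] imageI[OF that, of f, unfolded f(2)] by (auto simp: complete_sprouting_def)
  ultimately show ?thesis using K by (auto simp: complete_sprouting_def)
qed

text \<open>
  If one end \<open>y\<close> of \<open>e\<close> is a unit leaf, the other is not: otherwise \<open>e\<close> would be the only edge, and the
  contracted graph would have no metrics. Then one graph \<open>K0\<close> sprouts both \<open>G\<close> and the contraction, and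
  the two lines in its simplex coincide. If no end is a unit leaf, then \<open>e\<close> has length 0 along the
  whole line in the simplex of \<open>K0\<close>, which therefore lies in the face of the contracted \<open>K0\<close>.
\<close>

lemma slide_contraction:
  assumes G: "G \<in> stable_graphs g n d" and e: "e \<in> edges G" and d: "0 < d"
    and l: "l \<in> topspace (kappa (contract e G))" and t: "t \<in> {0..1}"
  shows "slide g n d (contract e G) l t =
    slide g n d G (extend_metric G (\<lambda>e'. if e' = e then None else Some e') l) t"
proof -
  let ?l = "extend_metric G (\<lambda>e'. if e' = e then None else Some e') l"
  note D = stable_graphsD[OF G]
  have G': "contract e G \<in> stable_graphs g n d" by (rule contract_stable[OF G e])
  note D' = stable_graphsD[OF G']
  have K: "complete_sprouting g n d (hat g n d G) G id id" using hat(1)[OF G] e by blast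
  define K0 where "K0 = hat g n d G"
  note K = K[folded K0_def]
  have KS: "K0 \<in> stable_graphs g n d" "full n K0" using K by (auto simp: complete_sprouting_def)
  note DK = stable_graphsD[OF KS(1)]
  have slide_G: "slide g n d G ?l t = point_of g n d K0 (flow d K0 G id ?l t)"
    by (simp add: slide_def K0_def)
  have EK: "edges G \<subseteq> edges K0" and endsK: "\<And>e. e \<in> edges G \<Longrightarrow> ends K0 e = ends G e"
    using K by (auto simp: complete_sprouting_def sprouting_def)
  show ?thesis
  proof (cases "\<exists>y\<in>ends G e. unit_leaf n G y")
    case True
    then obtain y where y: "y \<in> ends G e" "unit_leaf n G y" by blast
    then have "valence G y = 1" by (simp add: unit_leaf_def)
    then have "\<not> is_loop G e" using valence_one_iff[OF D(3)] y(1) e by blast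
    then obtain u v where "nonloop G e u v" using D(1) e nonloop_edgeI by blast
    then interpret nonloop G e u v .
    define x where "x = (if y = u then v else u)"
    have xy: "ends G e = {x, y}" using y(1) ends_e by (auto simp: x_def)
    have x: "\<not> unit_leaf n G x"
    proof
      assume "unit_leaf n G x"
      then have "valence G x = 1" by (simp add: unit_leaf_def)
      then have "valence G u = 1" "valence G v = 1" using \<open>valence G y = 1\<close> xy ends_e by (auto simp: doubleton_eq_iff)
      then have "valence (contract e G) u = 0" using valence_contract[of u] uv by simp
      moreover have "u \<in> verts (contract e G)" using uv by (simp add: contract_simps)
      ultimately show False using connected_valence_pos[OF D'(1,2) kappa_edges[OF l], of u] by simp
    qed
    obtain a where a: "complete_sprouting g n d K0 (contract e G) a id"
      using complete_sprouting_contract_leaf[OF G e xy y(2) x K] .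
    have "flow d K0 (contract e G) id l t = flow d K0 G id ?l t"
      using e by (auto simp: flow_def fun_eq_iff restrict_def inv_into_id extend_metric_def edges_contract)
    then show ?thesis using slide_eq[OF a G' d l t] slide_G by simp
  next
    case False
    have eK: "e \<in> edges K0" using EK e by blast
    have inner: "complete_sprouting g n d (contract e K0) (contract e G) id id"
      using complete_sprouting_contract_inner[OF G e _ K] False by blast
    have deg0: "deg K0 y = 0" if "y \<in> ends K0 e" for y
      using that False endsK[OF e] D(11)[OF e] K by (auto simp: complete_sprouting_def)
    have C: "contract e K0 \<in> stable_graphs g n d" by (rule contract_stable[OF KS(1) eK])
    note m = morphism.contraction[OF KS(1) C eK]
    have w: "leaf_weight (contract e K0) e' = leaf_weight K0 e'" if "e' \<in> edges K0" for e'
      by (rule leaf_weight_contract[OF DK(1) eK deg0 that])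
    have w0: "leaf_weight K0 e = 0" by (simp add: leaf_weight_def deg0)
    have "extend_metric K0 (\<lambda>e'. if e' = e then None else Some e') (flow d (contract e K0) (contract e G) id l t)
        = flow d K0 G id ?l t"
      using e w by (auto simp: flow_def fun_eq_iff restrict_def inv_into_id extend_metric_def edges_contract w0)
    then show ?thesis
      using slide_eq[OF inner G' d l t] slide_G point_of_morphism[OF m flow_kappa[OF inner d l t]] by simp
  qed
qed

lemma slide_morphism:
  assumes "morphism g n d G \<phi> G'" and d: "0 < d" and "l \<in> topspace (kappa G')" and t: "t \<in> {0..1}"
  shows "slide g n d G' l t = slide g n d G (extend_metric G \<phi> l) t"
  using assms(1,3)
proof (induction arbitrary: l rule: morphism.induct)
  case (iso G G' f h)
  let ?K = "hat g n d G'" and ?l = "extend_metric G (\<lambda>e. Some (h e)) l"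
  have K: "complete_sprouting g n d ?K G' id id" using hat(1)[OF iso(2) kappa_edges] iso.prems by blast
  have l: "?l \<in> topspace (kappa G)" by (rule extend_metric_kappa[OF morphism.iso[OF iso(1-3)] iso.prems])
  have h: "inj_on h (edges G)" "h ` edges G = edges G'" using iso(3) by (auto simp: graph_iso_def bij_betw_def)
  have "flow d ?K G (id \<circ> h) ?l t = flow d ?K G' id l t"
  proof
    fix e
    show "flow d ?K G (id \<circ> h) ?l t e = flow d ?K G' id l t e"
    proof (cases "e \<in> edges G'")
      case True
      then obtain e0 where "e0 \<in> edges G" "e = h e0" using h(2) by blast
      then show ?thesis using h True by (simp add: flow_def restrict_def inv_into_id extend_metric_def)
    next
      case False then show ?thesis using h by (simp add: flow_def restrict_def)
    qed
  qed
  then show ?case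
    using slide_eq[OF complete_sprouting_iso[OF iso(3,1,2) K] iso(1) d l t] by (simp add: slide_def)
next
  case (contraction G e)
  then show ?case using slide_contraction d t by blast
next
  case (comp G \<phi> G' \<psi> G'')
  have "slide g n d G'' l t = slide g n d G' (extend_metric G' \<psi> l) t" by (rule comp.IH(2)[OF comp.prems])
  also have "\<dots> = slide g n d G (extend_metric G \<phi> (extend_metric G' \<psi> l)) t"
    by (rule comp.IH(1)[OF extend_metric_kappa[OF comp.hyps(2) comp.prems]])
  finally show ?case by (simp add: extend_metric_comp[OF comp.hyps(1)])
qed

section \<open>The end point\<close>

text \<open>
  Edges without weight have length 0 in \<open>leaf_metric\<close>, so they can be contracted without moving the
  point.
\<close>

lemma star_reduction:
  assumes "K \<in> stable_graphs g n d" "full n K" and d: "0 < d"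
  shows "\<exists>S. S \<in> stable_graphs g n d \<and> full n S \<and> (\<forall>e\<in>edges S. \<exists>x\<in>ends S e. deg S x \<noteq> 0) \<and>
    point_of g n d S (leaf_metric d S) = point_of g n d K (leaf_metric d K)"
  using assms(1,2)
proof (induction "card (edges K)" arbitrary: K rule: less_induct)
  case less
  show ?case
  proof (cases "\<forall>e\<in>edges K. \<exists>x\<in>ends K e. deg K x \<noteq> 0")
    case True then show ?thesis using less.prems by blast
  next
    case False
    then obtain e where e: "e \<in> edges K" "\<And>x. x \<in> ends K e \<Longrightarrow> deg K x = 0" by blast
    note D = stable_graphsD[OF less.prems(1)]
    note C = contract_stable[OF less.prems(1) e(1)] full_contract[OF less.prems e]
    have "card (edges (contract e K)) < card (edges K)"
      using card_Diff1_less[OF D(3) e(1)] by (simp only: edges_contract)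
    from less.hyps[OF this C] obtain S where S: "S \<in> stable_graphs g n d" "full n S"
       "\<forall>e\<in>edges S. \<exists>x\<in>ends S e. deg S x \<noteq> 0"
       "point_of g n d S (leaf_metric d S) = point_of g n d (contract e K) (leaf_metric d (contract e K))" by blast
    have "extend_metric K (\<lambda>e'. if e' = e then None else Some e') (leaf_metric d (contract e K)) = leaf_metric d K"
      using leaf_weight_contract[OF D(1) e] e
      by (auto simp: extend_metric_def leaf_metric_def fun_eq_iff restrict_def edges_contract leaf_weight_def[of K e])
    then have "point_of g n d (contract e K) (leaf_metric d (contract e K)) = point_of g n d K (leaf_metric d K)"
      using point_of_morphism[OF morphism.contraction[OF less.prems(1) C(1) e(1)] leaf_metric_kappa[OF C d]] by simp
    then show ?thesis using S by metis
  qed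
qed

lemma leaf_metric_unique:
  assumes K: "K \<in> stable_graphs g n d" "full n K" and K': "K' \<in> stable_graphs g n d" "full n K'" and d: "0 < d"
  shows "point_of g n d K (leaf_metric d K) = point_of g n d K' (leaf_metric d K')"
proof -
  obtain S where S: "S \<in> stable_graphs g n d" "full n S" "\<forall>e\<in>edges S. \<exists>x\<in>ends S e. deg S x \<noteq> 0"
    and eq: "point_of g n d S (leaf_metric d S) = point_of g n d K (leaf_metric d K)"
    using star_reduction[OF K d] by blast
  obtain S' where S': "S' \<in> stable_graphs g n d" "full n S'" "\<forall>e\<in>edges S'. \<exists>x\<in>ends S' e. deg S' x \<noteq> 0"
    and eq': "point_of g n d S' (leaf_metric d S') = point_of g n d K' (leaf_metric d K')"
    using star_reduction[OF K' d] by blast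
  note D = stable_graphsD[OF S(1)] and D' = stable_graphsD[OF S'(1)]
  obtain c tip where c: "sprouting n S (point_graph g d) (\<lambda>_. c) id (\<lambda>_. 0) tip" "deg S c = of_bool (g = 0 \<and> n = 0 \<and> d = 2)"
    using star_sprouting[OF S(1,2)] S(3) by blast
  obtain c' tip' where c': "sprouting n S' (point_graph g d) (\<lambda>_. c') id (\<lambda>_. 0) tip'" "deg S' c' = of_bool (g = 0 \<and> n = 0 \<and> d = 2)"
    using star_sprouting[OF S'(1,2)] S'(3) by blast
  obtain f h where iso: "graph_iso n S S' f h"
    by (rule sprouting_unique[OF c(1) c'(1) D(3) D'(3)]) (use c(2) c'(2) in \<open>auto simp: point_graph_def\<close>)
  have "point_of g n d S (leaf_metric d S) = point_of g n d S' (leaf_metric d S')"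
  proof (rule point_of_iso[OF S(1) S'(1) iso leaf_metric_kappa[OF S'(1,2) d]])
    fix e assume e: "e \<in> edges S"
    then have "h e \<in> edges S'" using iso by (auto simp: graph_iso_def bij_betw_def)
    then show "leaf_metric d S e = leaf_metric d S' (h e)"
      using e leaf_weight_iso[OF iso e D(11)[OF e]] by (simp add: leaf_metric_def)
  qed (simp add: leaf_metric_def)
  then show ?thesis using eq eq' by simp
qed

lemma flow_1: "flow d K G j l 1 = leaf_metric d K"
  by (simp add: flow_def leaf_metric_def)

lemma slide_1:
  assumes G: "G \<in> stable_graphs g n d" "l \<in> topspace (kappa G)"
    and K: "K \<in> stable_graphs g n d" "full n K" and d: "0 < d"
  shows "slide g n d G l 1 = point_of g n d K (leaf_metric d K)"
  using hat(1)[OF G(1) kappa_edges[OF G(2)]] leaf_metric_unique[OF _ _ K d]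
  by (simp add: slide_def flow_1 complete_sprouting_def)

lemma slide_leaf_metric:
  assumes K: "K \<in> stable_graphs g n d" "full n K" and d: "0 < d" and t: "t \<in> {0..1}"
  shows "slide g n d K (leaf_metric d K) t = point_of g n d K (leaf_metric d K)"
proof -
  have "flow d K K id (leaf_metric d K) t = leaf_metric d K"
    by (auto simp: flow_def leaf_metric_def fun_eq_iff restrict_def inv_into_id algebra_simps)
  then show ?thesis
    using slide_eq[OF complete_sprouting_refl[OF K] K(1) d leaf_metric_kappa[OF K d] t] by simp
qed

section \<open>Continuity\<close>

text \<open>
  A disjoint union times \<open>T\<close> is the disjoint union of the products, so continuity can be checked on each
  summand.
\<close>

lemma continuous_map_sum_prod:
  assumes "\<And>i. i \<in> I \<Longrightarrow> continuous_map (prod_topology (X i) T) Y (\<lambda>(x, t). F ((i, x), t))"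
  shows "continuous_map (prod_topology (sum_topology X I) T) Y F"
  unfolding continuous_map_def
proof (intro conjI allI impI)
  show "F \<in> topspace (prod_topology (sum_topology X I) T) \<rightarrow> topspace Y"
    using assms by (force simp: continuous_map_def)
  fix U assume U: "openin Y U"
  show "openin (prod_topology (sum_topology X I) T) {z \<in> topspace (prod_topology (sum_topology X I) T). F z \<in> U}"
    unfolding openin_prod_topology_alt
  proof (intro allI impI)
    fix p t assume pt: "(p, t) \<in> {z \<in> topspace (prod_topology (sum_topology X I) T). F z \<in> U}"
    then obtain i x where p: "p = (i, x)" "i \<in> I" "x \<in> topspace (X i)" "t \<in> topspace T" "F ((i, x), t) \<in> U" by auto
    let ?W = "{z \<in> topspace (prod_topology (X i) T). (case z of (x, t) \<Rightarrow> F ((i, x), t)) \<in> U}"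
    have W: "openin (prod_topology (X i) T) ?W" by (rule openin_continuous_map_preimage[OF assms[OF p(2)] U])
    have "(x, t) \<in> ?W" using p by simp
    then obtain A B where AB: "openin (X i) A" "openin T B" "x \<in> A" "t \<in> B" "A \<times> B \<subseteq> ?W"
      using W unfolding openin_prod_topology_alt by meson
    have "openin (sum_topology X I) (Pair i ` A)"
      using open_map_component_injection[OF p(2)] AB(1) by (auto simp: open_map_def)
    moreover have "p \<in> Pair i ` A" using p AB by blast
    moreover have "Pair i ` A \<times> B \<subseteq> {z \<in> topspace (prod_topology (sum_topology X I) T). F z \<in> U}"
      using AB(5) p(2) by auto
    ultimately show "\<exists>V W. openin (sum_topology X I) V \<and> openin T W \<and> p \<in> V \<and> t \<in> W \<and>
       V \<times> W \<subseteq> {z \<in> topspace (prod_topology (sum_topology X I) T). F z \<in> U}"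
      using AB(2,4) by blast
  qed
qed

lemma continuous_map_flow:
  assumes K: "complete_sprouting g n d K G a j" and d: "0 < d"
  shows "continuous_map (prod_topology (kappa G) (top_of_set {0..1})) (kappa K) (\<lambda>(l, t). flow d K G j l t)"
proof -
  let ?P = "prod_topology (kappa G) (top_of_set {0..1::real})"
  have t: "continuous_map ?P euclideanreal snd"
    using continuous_map_snd[of "kappa G" "top_of_set {0..1::real}"] by (rule continuous_map_into_fulltopology)
  have l: "continuous_map ?P euclideanreal (\<lambda>z. fst z e)" if "e \<in> edges G" for e
  proof -
    have "continuous_map (kappa G) euclideanreal (\<lambda>l. l e)"
      unfolding kappa_def by (intro continuous_map_from_subtopology continuous_map_product_projection that)
    then show ?thesis using continuous_map_compose[OF continuous_map_fst] by (force simp: o_def)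
  qed
  have "continuous_map ?P (powertop_real (edges K)) (\<lambda>(l, t). flow d K G j l t)"
    unfolding continuous_map_componentwise
  proof (intro conjI ballI)
    show "(\<lambda>(l, t). flow d K G j l t) ` topspace ?P \<subseteq> extensional (edges K)"
      by (auto simp: flow_def)
    fix e assume e: "e \<in> edges K"
    have "continuous_map ?P euclideanreal (\<lambda>z. (1 - snd z) *
        (if e \<in> j ` edges G then fst z (inv_into (edges G) j e) else 0) + snd z * c)" for c
      by (cases "e \<in> j ` edges G") (auto intro!: continuous_intros t l inv_into_into)
    then show "continuous_map ?P euclideanreal (\<lambda>x. (case x of (l, t) \<Rightarrow> flow d K G j l t) e)"
      using e by (simp add: flow_def case_prod_unfold flip: times_divide_eq_right)
  qed
  moreover have "(\<lambda>(l, t). flow d K G j l t) \<in> topspace ?P \<rightarrow>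
      {l. (\<forall>e\<in>edges K. 0 \<le> l e) \<and> (\<Sum>e\<in>edges K. l e) = 1}"
    using flow_kappa[OF K d, unfolded mem_kappa[of _ K]] by auto
  ultimately show ?thesis
    unfolding kappa_def[of K] continuous_map_in_subtopology by blast
qed

lemma continuous_map_point_of:
  assumes "G \<in> stable_graphs g n d"
  shows "continuous_map (kappa G) (virtual_dual_complex g n d) (point_of g n d G)"
proof -
  have "continuous_map (kappa G) (virtual_dual_complex g n d)
     ((\<lambda>p. colimit_rel kappa (stable_graphs g n d) (arrows g n d) `` {p}) \<circ> Pair G)"
    unfolding virtual_dual_complex_eq
    by (rule continuous_map_compose[OF continuous_map_component_injection[OF assms] 
       quotient_imp_continuous_map[OF quotient_map_colimit]])
  then show ?thesis by (simp add: o_def point_of_def[abs_def])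
qed

lemma continuous_map_slide:
  assumes d: "0 < d"
  shows "continuous_map (prod_topology (sum_topology kappa (stable_graphs g n d)) (top_of_set {0..1}))
     (virtual_dual_complex g n d) (\<lambda>((G, l), t). slide g n d G l t)"
proof (rule continuous_map_sum_prod, unfold prod.case)
  fix G assume G: "G \<in> stable_graphs g n d"
  show "continuous_map (prod_topology (kappa G) (top_of_set {0..1})) (virtual_dual_complex g n d)
     (\<lambda>(l, t). slide g n d G l t)"
  proof (cases "edges G = {}")
    case True
    then have "topspace (kappa G) = {}" using kappa_edges by blast
    then show ?thesis by (simp add: continuous_map_on_empty)
  next
    case False
    note K = hat(1)[OF G False]
    have "hat g n d G \<in> stable_graphs g n d" using K by (simp add: complete_sprouting_def)
    from continuous_map_compose[OF continuous_map_flow[OF K d] continuous_map_point_of[OF this]]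
    show ?thesis by (simp add: o_def slide_def case_prod_unfold)
  qed
qed

section \<open>The deformation retraction\<close>

lemma slide_colimit_rel:
  assumes d: "0 < d" and t: "t \<in> {0..1}"
    and "((G, l), (G', l')) \<in> colimit_rel kappa (stable_graphs g n d) (arrows g n d)"
  shows "slide g n d G l t = slide g n d G' l' t"
proof -
  define R where "R p q \<longleftrightarrow> (\<exists>(i, j, f)\<in>arrows g n d. \<exists>x\<in>topspace (kappa i). p = (i, x) \<and> q = (j, f x))" for p q
  have arrow: "slide g n d (fst p) (snd p) t = slide g n d (fst q) (snd q) t" if "R p q" for p q
    using that slide_morphism[OF _ d _ t] by (fastforce simp: R_def arrows_def)
  have "equivclp R (G, l) (G', l')"
    using assms(3) unfolding colimit_rel_def R_def by blast
  then have "slide g n d (fst (G, l)) (snd (G, l)) t = slide g n d (fst (G', l')) (snd (G', l')) t"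
  proof (induction rule: equivclp_induct)
    case (step y z) then show ?case using arrow by metis
  qed simp
  then show ?thesis by simp
qed

definition leaf_retraction :: "nat \<Rightarrow> nat \<Rightarrow> nat \<Rightarrow> (wgraph \<times> (nat \<Rightarrow> real)) set \<times> real \<Rightarrow> (wgraph \<times> (nat \<Rightarrow> real)) set" where
  "leaf_retraction g n d = (\<lambda>(C, t). let (G, l) = SOME p. p \<in> C in slide g n d G l t)"

lemma leaf_retraction_point_of:
  assumes d: "0 < d" and t: "t \<in> {0..1}" and G: "G \<in> stable_graphs g n d" "l \<in> topspace (kappa G)"
  shows "leaf_retraction g n d (point_of g n d G l, t) = slide g n d G l t"
proof -
  have "(G, l) \<in> point_of g n d G l"
    using equiv_class_self[OF equiv_colimit_rel, of "(G, l)" kappa "stable_graphs g n d"] G by (simp add: point_of_def)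
  then have "(SOME p. p \<in> point_of g n d G l) \<in> point_of g n d G l" by (rule someI)
  moreover obtain G' l' where p: "(SOME p. p \<in> point_of g n d G l) = (G', l')" by fastforce
  ultimately have "((G, l), (G', l')) \<in> colimit_rel kappa (stable_graphs g n d) (arrows g n d)"
    by (simp add: point_of_def)
  then show ?thesis using slide_colimit_rel[OF d t] p by (simp add: leaf_retraction_def)
qed

lemma topspace_virtual_dual_complex:
  "topspace (virtual_dual_complex g n d) = {point_of g n d G l | G l. G \<in> stable_graphs g n d \<and> l \<in> topspace (kappa G)}"
  unfolding virtual_dual_complex_eq topspace_colimit quotient_def point_of_def by (auto; blast)

lemma deformation_retraction_leaf_retraction:
  assumes d: "0 < d" and K: "K \<in> stable_graphs g n d" "full n K"
  shows "deformation_retraction_onto (virtual_dual_complex g n d) {point_of g n d K (leaf_metric d K)} (leaf_retraction g n d)"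
  unfolding deformation_retraction_onto_def
proof (intro conjI)
  have lm: "leaf_metric d K \<in> topspace (kappa K)" by (rule leaf_metric_kappa[OF K d])
  then show "{point_of g n d K (leaf_metric d K)} \<subseteq> topspace (virtual_dual_complex g n d)"
    using K(1) by (auto simp: topspace_virtual_dual_complex)
  let ?T = "top_of_set {0..1::real}" and ?q = "\<lambda>p. colimit_rel kappa (stable_graphs g n d) (arrows g n d) `` {p}"
  let ?S = "sum_topology kappa (stable_graphs g n d)"
  have "locally_compact_space ?T" "Hausdorff_space ?T"
    by (auto intro!: compact_imp_locally_compact_space Hausdorff_space_subtopology simp: compact_space_subtopology)
  then have q: "quotient_map (prod_topology ?S ?T) (prod_topology (virtual_dual_complex g n d) ?T) (\<lambda>(p, t). (?q p, t))"
    unfolding virtual_dual_complex_eq by (intro quotient_map_prod_left quotient_map_colimit) auto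
  have "continuous_map (prod_topology ?S ?T) (virtual_dual_complex g n d) (leaf_retraction g n d \<circ> (\<lambda>(p, t). (?q p, t)))"
    by (rule continuous_map_eq[OF continuous_map_slide[OF d]])
      (use leaf_retraction_point_of[OF d] in \<open>auto simp: point_of_def\<close>)
  then show "continuous_map (prod_topology (virtual_dual_complex g n d) ?T) (virtual_dual_complex g n d) (leaf_retraction g n d)"
    by (rule continuous_compose_quotient_map[OF q])
  show "\<forall>x\<in>topspace (virtual_dual_complex g n d). leaf_retraction g n d (x, 0) = x \<and>
       leaf_retraction g n d (x, 1) \<in> {point_of g n d K (leaf_metric d K)}"
    using slide_0 slide_1[OF _ _ K d] by (auto simp: topspace_virtual_dual_complex leaf_retraction_point_of[OF d])
  show "\<forall>a\<in>{point_of g n d K (leaf_metric d K)}. \<forall>t\<in>{0..1}. leaf_retraction g n d (a, t) = a"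
    using leaf_retraction_point_of[OF d _ K(1) lm] slide_leaf_metric[OF K d] by auto
qed

lemma deformation_retraction_imp_contractible:
  assumes "deformation_retraction_onto X {p} H"
  shows "contractible_space X"
proof -
  have H: "continuous_map (prod_topology X (top_of_set {0..1})) X H"
    "\<And>x. x \<in> topspace X \<Longrightarrow> H (x, 0) = x \<and> H (x, 1) = p"
    using assms by (auto simp: deformation_retraction_onto_def)
  have c: "continuous_map (prod_topology (top_of_set {0..1::real}) X) X (H \<circ> (\<lambda>(t, x). (x, t)))"
    by (rule continuous_map_compose[OF homeomorphic_imp_continuous_map[OF homeomorphic_map_swap] H(1)])
  have "homotopic_with (\<lambda>x. True) X X id (\<lambda>x. p)"
    by (subst homotopic_with) (use c H(2) in \<open>auto intro!: exI[of _ "H \<circ> (\<lambda>(t, x). (x, t))"]\<close>)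
  then show ?thesis by (auto simp: contractible_space_def)
qed

text \<open>
  Without stable graphs that have an edge the complex is empty, hence contractible in the sense of
  \<open>contractible_space\<close>.
\<close>

theorem theorem5p7:
  fixes g n d :: nat
  assumes "d > 0"
  shows "(\<not> (g = 0 \<and> n \<le> 1 \<and> d = 1) \<longrightarrow>
            (\<exists>p H. deformation_retraction_onto (virtual_dual_complex g n d) {p} H)) \<and>
         contractible_space (virtual_dual_complex g n d)"
proof -
  have retract: "\<exists>p H. deformation_retraction_onto (virtual_dual_complex g n d) {p} H"
    if "G \<in> stable_graphs g n d" "edges G \<noteq> {}" for G
    using hat(1)[OF that] deformation_retraction_leaf_retraction[OF assms] unfolding complete_sprouting_def by blast
  show ?thesis
  proof (cases "\<exists>G\<in>stable_graphs g n d. edges G \<noteq> {}")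
    case True
    then obtain p H where H: "deformation_retraction_onto (virtual_dual_complex g n d) {p} H"
      using retract by blast
    then have "contractible_space (virtual_dual_complex g n d)"
      by (rule deformation_retraction_imp_contractible)
    with H show ?thesis by (intro conjI impI exI)
  next
    case False
    then have "topspace (virtual_dual_complex g n d) = {}"
      using kappa_edges by (fastforce simp: topspace_virtual_dual_complex)
    then have "virtual_dual_complex g n d = trivial_topology" by simp
    then have "contractible_space (virtual_dual_complex g n d)" by simp
    moreover have "g = 0 \<and> n \<le> 1 \<and> d = 1"
    proof (rule ccontr)
      assume "\<not> (g = 0 \<and> n \<le> 1 \<and> d = 1)"
      with assms obtain G where "G \<in> stable_graphs g n d" "edges G \<noteq> {}"
        by (rule stable_graph_with_edge)
      then show False using False by blast
    qed
    ultimately show ?thesis by simp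
  qed
qed

end
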